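(* For sample size $u\ge n^{2}$, $Q^{a}(\mathrm{Pol}_{1},u)=\Theta(n/\log u)$. In particular, active testing of linear functions with a polynomial-size sample set requires $\Theta(n/\log n)$ queries.
   Context: Boolean functions are maps $f:\mathbb{Z}_2^n\to\mathbb{Z}_2$; $f$ is $\epsilon$-far from a family $\mathcal{P}$ if $|\{x:f(x)\ne g(x)\}|\ge\epsilon2^n$ for all $g\in\mathcal{P}$. A $u$-sample $q$-query $\epsilon$-tester for $\mathcal{P}$ is a randomized algorithm that, given a set $U\subseteq\mathbb{Z}_2^n$ of $u$ points drawn uniformly at random, queries an unknown $f$ on $q$ inputs from $U$, accepts with probability $\ge2/3$ if $f\in\mathcal{P}$ and rejects with probability $\ge2/3$ if $f$ is $\epsilon$-far from $\mathcal{P}$; $Q^a_\epsilon(\mathcal{P},u)$ is the minimal such $q$. $\epsilon$ is a fixed small constant (e.g. $0.001$) omitted from notation; asymptotics as $n\to\infty$; logarithms base 2. Here $\mathrm{Pol}_1$ denotes the family of linear functions $f(x)=\sum_{i\in S}x_i$ over $\mathbb{Z}_2$, $S\subseteq[n]$. *)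

theory Defs
  imports
    "HOL-Probability.Probability"
    "HOL-Library.Z2"
    "HOL-Library.Landau_Symbols"
    "HOL-Library.Extended_Nat"
begin

type_synonym point = "nat \<Rightarrow> bit"

definition cube :: "nat \<Rightarrow> point set"
  where "cube n = ({..<n} \<rightarrow>\<^sub>E UNIV)"

definition boolean_functions :: "nat \<Rightarrow> (point \<Rightarrow> bit) set"
  where "boolean_functions n = (cube n \<rightarrow>\<^sub>E UNIV)"

definition Pol1 :: "nat \<Rightarrow> (point \<Rightarrow> bit) set"
  where "Pol1 n = {(\<lambda>x\<in>cube n. \<Sum>i\<in>S. x i) | S. S \<subseteq> {..<n}}"

definition far_from :: "real \<Rightarrow> nat \<Rightarrow> (point \<Rightarrow> bit) \<Rightarrow> (point \<Rightarrow> bit) set \<Rightarrow> bool"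
  where "far_from \<epsilon> n f P \<longleftrightarrow>
    (\<forall>g\<in>P. real (card {x \<in> cube n. f x \<noteq> g x}) \<ge> \<epsilon> * 2 ^ n)"

text \<open>
  A run of an adaptive query algorithm with fixed coin tosses is a decision tree:
  \<open>Query x t0 t1\<close> asks for the value of the unknown function at \<open>x\<close> and continues with \<open>t0\<close>
  on answer 0 and with \<open>t1\<close> on answer 1; \<open>Decide True\<close> accepts. The generated function
  \<open>queries\<close> collects all points that occur in a tree.
\<close>

datatype (queries: 'a) dtree =
  Decide bool
| Query 'a "'a dtree" "'a dtree"

primrec depth :: "'a dtree \<Rightarrow> nat" where
  "depth (Decide b) = 0"
| "depth (Query x t0 t1) = Suc (max (depth t0) (depth t1))"

primrec run :: "('a \<Rightarrow> bit) \<Rightarrow> 'a dtree \<Rightarrow> bool" where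
  "run f (Decide b) = b"
| "run f (Query x t0 t1) = (if f x = 0 then run f t0 else run f t1)"

text \<open>
  Samples are sets, hence drawn without repetition; this is meaningful only for \<open>u \<le> 2 ^ n\<close>.
\<close>

definition samples :: "nat \<Rightarrow> nat \<Rightarrow> point set set"
  where "samples n u = {U. U \<subseteq> cube n \<and> card U = u}"

text \<open>
  A randomized algorithm maps the sample \<open>U\<close> to a distribution on decision trees. The
  acceptance probability is taken over both the sample and the coin tosses.
\<close>

definition outcome ::
    "nat \<Rightarrow> nat \<Rightarrow> (point set \<Rightarrow> point dtree pmf) \<Rightarrow> (point \<Rightarrow> bit) \<Rightarrow> bool pmf"
  where "outcome n u A f =
    bind_pmf (pmf_of_set (samples n u)) (\<lambda>U. map_pmf (run f) (A U))"

definition tester ::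
    "real \<Rightarrow> nat \<Rightarrow> (point \<Rightarrow> bit) set \<Rightarrow> nat \<Rightarrow> nat \<Rightarrow> (point set \<Rightarrow> point dtree pmf) \<Rightarrow> bool"
  where "tester \<epsilon> n P u q A \<longleftrightarrow>
    (\<forall>U\<in>samples n u. \<forall>t\<in>set_pmf (A U). queries t \<subseteq> U \<and> depth t \<le> q) \<and>
    (\<forall>f\<in>P. pmf (outcome n u A f) True \<ge> 2 / 3) \<and>
    (\<forall>f\<in>boolean_functions n. far_from \<epsilon> n f P \<longrightarrow> pmf (outcome n u A f) False \<ge> 2 / 3)"

text \<open>The value is \<open>\<infinity>\<close> if there is no tester at all.\<close>

definition active_query_complexity ::
    "real \<Rightarrow> nat \<Rightarrow> (point \<Rightarrow> bit) set \<Rightarrow> nat \<Rightarrow> enat"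
  where "active_query_complexity \<epsilon> n P u = Inf {enat q | q. \<exists>A. tester \<epsilon> n P u q A}"

text \<open>
  The library's Landau symbols need values in a normed field, so finiteness is required
  separately.
\<close>

definition enat_bigtheta :: "'a filter \<Rightarrow> ('a \<Rightarrow> enat) \<Rightarrow> ('a \<Rightarrow> real) \<Rightarrow> bool"
  where "enat_bigtheta F Q g \<longleftrightarrow>
    (\<forall>\<^sub>F x in F. Q x \<noteq> \<infinity>) \<and> (\<lambda>x. real (the_enat (Q x))) \<in> \<Theta>[F](g)"

text \<open>
  The limit \<open>n \<rightarrow> \<infinity>\<close>, uniformly in all sample sizes \<open>u\<close> with \<open>n\<^sup>2 \<le> u \<le> 2 ^ n\<close>: a property
  holds eventually iff, from some \<open>n\<close> on, it holds for every such \<open>u\<close>.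
\<close>

definition large_samples :: "(nat \<times> nat) filter"
  where "large_samples =
    inf (filtercomap fst at_top) (principal {(n, u). n ^ 2 \<le> u \<and> u \<le> 2 ^ n})"

lemma eventually_large_samples:
  "eventually P large_samples \<longleftrightarrow>
    (\<exists>N. \<forall>n\<ge>N. \<forall>u. n ^ 2 \<le> u \<and> u \<le> 2 ^ n \<longrightarrow> P (n, u))"
  unfolding large_samples_def eventually_inf_principal eventually_filtercomap
    eventually_at_top_linorder
proof
  assume "\<exists>Q. (\<exists>N. \<forall>n\<ge>N. Q n) \<and>
    (\<forall>x. Q (fst x) \<longrightarrow> x \<in> {(n, u). n ^ 2 \<le> u \<and> u \<le> 2 ^ n} \<longrightarrow> P x)"
  then show "\<exists>N. \<forall>n\<ge>N. \<forall>u. n ^ 2 \<le> u \<and> u \<le> 2 ^ n \<longrightarrow> P (n, u)"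
    by fastforce
next
  assume "\<exists>N. \<forall>n\<ge>N. \<forall>u. n ^ 2 \<le> u \<and> u \<le> 2 ^ n \<longrightarrow> P (n, u)"
  then obtain N where "\<forall>n\<ge>N. \<forall>u. n ^ 2 \<le> u \<and> u \<le> 2 ^ n \<longrightarrow> P (n, u)" ..
  then show "\<exists>Q. (\<exists>N. \<forall>n\<ge>N. Q n) \<and>
    (\<forall>x. Q (fst x) \<longrightarrow> x \<in> {(n, u). n ^ 2 \<le> u \<and> u \<le> 2 ^ n} \<longrightarrow> P x)"
    by (intro exI[of _ "\<lambda>n. n \<ge> N"]) auto
qed

end

theory Submission
  imports Defs "HOL-Real_Asymp.Real_Asymp"
begin

text \<open>
  Lower bound. If no nonempty set of at most \<open>q\<close> sample points sums to zero, then both a random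
  linear function and the complement \<open>1 + \<chi>\<close> of one answer any \<open>q\<close> queries by uniform bits. As
  linear functions are homogeneous, such complements are \<open>1/2\<close>-far from them, so a tester has to
  tell the two families apart. A sample violates the condition with probability at most
  \<open>q * u ^ q / 2 ^ n\<close>, which tends to \<open>0\<close> when \<open>q\<close> is below \<open>n / (2 * log 2 u)\<close>.

  Upper bound. Among many sample points there are many \<open>k\<close>-sets with sum zero, where \<open>k\<close> is an odd
  number of order \<open>n / log 2 u\<close>; the test picks one at random and checks that \<open>f\<close> sums to zero on it.
  Linear functions always pass. For a uniform \<open>k\<close>-tuple with sum zero the mean of \<open>(-1) ^ \<Sum>f\<close> is the
  sum of the \<open>k\<close>-th powers of the Fourier coefficients, at most \<open>(1 - 2 * \<epsilon>) ^ (k - 2)\<close> for odd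
  \<open>k\<close> and \<open>\<epsilon>\<close>-far \<open>f\<close>, so a check passes with probability close to \<open>1/2\<close>. Two checks in
  disjoint halves of the sample, with the same index set, bring this close to \<open>1/4\<close>. For
  independent uniform points the events that the index sets sum to zero are pairwise independent,
  so the number of dependencies concentrates. Restricting to \<open>v\<close> indices per half with
  \<open>v\<^sup>2\<close> small compared to \<open>2 ^ n\<close> makes sampling without repetition harmless.
\<close>

section \<open>Fourier analysis on the cube\<close>

definition sg :: "bit \<Rightarrow> real"
  where "sg b = (if b = 0 then 1 else -1)"

definition chi :: "nat set \<Rightarrow> point \<Rightarrow> real"
  where "chi S x = (\<Prod>i\<in>S. sg (x i))"

text \<open>A family instead of a set of points, so that repeated points count with multiplicity. A
  set \<open>T\<close> of points is treated as the identity family on \<open>T\<close>.\<close>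

definition zsum :: "nat \<Rightarrow> 'i set \<Rightarrow> ('i \<Rightarrow> point) \<Rightarrow> bool"
  where "zsum n T X \<longleftrightarrow> (\<forall>j<n. (\<Sum>i\<in>T. X i j) = 0)"

text \<open>Not normalised: this is the usual Fourier coefficient times \<open>2 ^ n\<close>, whence
  the powers of \<open>2 ^ n\<close> in the bounds below.\<close>

definition fourier :: "nat \<Rightarrow> (point \<Rightarrow> real) \<Rightarrow> nat set \<Rightarrow> real"
  where "fourier n F S = (\<Sum>x\<in>cube n. F x * chi S x)"

text \<open>This rewrite rule turns sums of bits into Boolean case distinctions.\<close>

declare add_bit_eq_xor [simp del]

lemma UNIV_bit: "(UNIV :: bit set) = {0, 1}"
  by (auto intro: bit.exhaust)

lemma finite_UNIV_bit [simp]: "finite (UNIV :: bit set)"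
  by (simp add: UNIV_bit)

lemma bit_eq_iff_add: "(a::bit) = b \<longleftrightarrow> a + b = 0"
  by (cases a; cases b) simp_all

lemma sg_simps [simp]: "sg 0 = 1" "sg 1 = -1"
  by (simp_all add: sg_def)

lemma sg_add: "sg (a + b) = sg a * sg b"
  by (cases a; cases b) simp_all

lemma sg_sum: "sg (\<Sum>i\<in>A. f i) = (\<Prod>i\<in>A. sg (f i))"
  by (induction A rule: infinite_finite_induct) (simp_all add: sg_add)

lemma sg_mult_self [simp]: "sg b * sg b = 1"
  by (cases b) simp_all

lemma finite_cube [simp]: "finite (cube n)"
  unfolding cube_def by (intro finite_PiE) simp_all

lemma card_cube [simp]: "card (cube n) = 2 ^ n"
  unfolding cube_def by (subst card_funcsetE) (simp_all add: UNIV_bit numeral_2_eq_2)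

lemma cube_ne [simp]: "cube n \<noteq> {}"
  using card_cube[of n] by (metis card.empty power_not_zero zero_neq_numeral)

lemma of_bool_bit: "of_bool (b = 0) = (1 + sg b) / 2"
  by (cases b) simp_all

text \<open>Expanding the product of the factors \<open>sg (z j) + 1\<close> over subsets gives the
  left side; a single \<open>z j = 1\<close> makes that product vanish.\<close>

lemma sum_characters:
  "(\<Sum>S\<in>Pow {..<n}. \<Prod>i\<in>S. sg (z i)) = 2 ^ n * of_bool (\<forall>j<n. z j = 0)"
proof -
  have "(\<Sum>S\<in>Pow {..<n}. \<Prod>i\<in>S. sg (z i)) = (\<Prod>i<n. sg (z i) + 1)"
    by (subst prod_add) simp_all
  also have "\<dots> = 2 ^ n * of_bool (\<forall>j<n. z j = 0)"
  proof (cases "\<forall>j<n. z j = 0")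
    case False
    then obtain j where "j < n" "z j = 1" by auto
    then have "(\<Prod>i<n. sg (z i) + 1) = 0"
      by (intro prod_zero) (auto intro!: bexI[of _ j])
    with False show ?thesis by simp
  qed simp
  finally show ?thesis .
qed

text \<open>The mean of all characters at the sum of the points detects zero. As characters are
  multiplicative, the indicator becomes a mean of products over single points, so sums over
  independent points factorise.\<close>

lemma of_bool_zsum:
  "of_bool (zsum n I X) = (\<Sum>S\<in>Pow {..<n}. \<Prod>i\<in>I. chi S (X i)) / 2 ^ n"
proof -
  have "(\<Sum>S\<in>Pow {..<n}. \<Prod>i\<in>I. chi S (X i)) = (\<Sum>S\<in>Pow {..<n}. \<Prod>j\<in>S. sg (\<Sum>i\<in>I. X i j))"
    unfolding chi_def by (subst prod.swap) (simp add: sg_sum)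
  then show ?thesis
    unfolding zsum_def by (simp add: sum_characters)
qed

lemma sum_cube_chi:
  assumes "S \<subseteq> {..<n}"
  shows "(\<Sum>x\<in>cube n. chi S x) = 2 ^ n * of_bool (S = {})"
proof -
  have "(\<Sum>x\<in>cube n. chi S x) = (\<Sum>x\<in>cube n. \<Prod>i<n. if i \<in> S then sg (x i) else 1)"
    unfolding chi_def using assms
    by (intro sum.cong refl) (simp add: prod.If_cases Int_absorb1)
  also have "\<dots> = (\<Prod>i<n. \<Sum>b\<in>UNIV. if i \<in> S then sg b else 1)"
    unfolding cube_def by (rule prod_sum_PiE[symmetric]) simp_all
  also have "\<dots> = (\<Prod>i<n. if i \<in> S then 0 else 2)"
    by (intro prod.cong refl) (simp add: UNIV_bit)
  also have "\<dots> = 2 ^ n * of_bool (S = {})"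
    using assms by (auto intro!: prod_zero)
  finally show ?thesis .
qed

text \<open>By \<open>of_bool_zsum\<close> the left side splits into one sum for each character
  \<open>S\<close>, which factorises over the indices: an index in \<open>I\<close> contributes the
  coefficient of \<open>F\<close> at \<open>S\<close>, any other index the factor
  \<open>2 ^ n\<close>.\<close>

lemma sum_zsum_prod:
  fixes F :: "point \<Rightarrow> real"
  assumes "finite V" "I \<subseteq> V"
  shows "(\<Sum>X\<in>V \<rightarrow>\<^sub>E cube n. of_bool (zsum n I X) * (\<Prod>i\<in>I. F (X i)))
    = 2 ^ (n * (card V - card I)) * (\<Sum>S\<in>Pow {..<n}. fourier n F S ^ card I) / 2 ^ n"
proof -
  have fin: "finite I" using assms finite_subset by blast
  have inner: "(\<Sum>X\<in>V \<rightarrow>\<^sub>E cube n. \<Prod>i\<in>I. F (X i) * chi S (X i))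
      = 2 ^ (n * (card V - card I)) * fourier n F S ^ card I" for S
  proof -
    have "(\<Sum>X\<in>V \<rightarrow>\<^sub>E cube n. \<Prod>i\<in>I. F (X i) * chi S (X i))
        = (\<Sum>X\<in>V \<rightarrow>\<^sub>E cube n. \<Prod>i\<in>V. if i \<in> I then F (X i) * chi S (X i) else 1)"
      using assms by (intro sum.cong refl) (simp add: prod.If_cases Int_absorb1)
    also have "\<dots> = (\<Prod>i\<in>V. \<Sum>x\<in>cube n. if i \<in> I then F x * chi S x else 1)"
      using assms by (intro prod_sum_PiE[symmetric]) simp_all
    also have "\<dots> = (\<Prod>i\<in>V. if i \<in> I then fourier n F S else 2 ^ n)"
      by (intro prod.cong refl) (simp add: fourier_def)
    also have "\<dots> = fourier n F S ^ card I * (2 ^ n) ^ card (V - I)"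
      using assms by (simp add: prod.If_cases Int_absorb1 Diff_eq)
    also have "card (V - I) = card V - card I"
      using assms fin by (simp add: card_Diff_subset)
    finally show ?thesis by (simp add: power_mult mult.commute)
  qed
  have "(\<Sum>X\<in>V \<rightarrow>\<^sub>E cube n. of_bool (zsum n I X) * (\<Prod>i\<in>I. F (X i)))
    = (\<Sum>X\<in>V \<rightarrow>\<^sub>E cube n. \<Sum>S\<in>Pow {..<n}. \<Prod>i\<in>I. F (X i) * chi S (X i)) / 2 ^ n"
    by (simp add: of_bool_zsum sum_distrib_left sum_distrib_right sum_divide_distrib prod.distrib mult_ac)
  also have "\<dots> = (\<Sum>S\<in>Pow {..<n}. 2 ^ (n * (card V - card I)) * fourier n F S ^ card I) / 2 ^ n"
    by (subst sum.swap) (simp only: inner)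
  finally show ?thesis by (simp add: sum_distrib_left)
qed

lemma fourier_one:
  assumes "S \<subseteq> {..<n}"
  shows "fourier n (\<lambda>_. 1) S = 2 ^ n * of_bool (S = {})"
  using sum_cube_chi[OF assms] by (simp add: fourier_def)

text \<open>The case \<open>F = 1\<close>, where only the trivial character has a nonzero
  coefficient: a fixed nonempty index set sums to zero with probability
  \<open>1 / 2 ^ n\<close>.\<close>

lemma sum_zsum:
  assumes "finite V" "I \<subseteq> V" "I \<noteq> {}"
  shows "(\<Sum>X\<in>V \<rightarrow>\<^sub>E cube n. of_bool (zsum n I X)) = (2 ^ (n * card V) / 2 ^ n :: real)"
proof -
  have "finite I" using assms finite_subset by blast
  then have pos: "card I > 0" using assms by (simp add: card_gt_0_iff)
  have le: "card I \<le> card V" using assms by (simp add: card_mono)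
  have "(\<Sum>S\<in>Pow {..<n}. fourier n (\<lambda>_. 1) S ^ card I)
      = (\<Sum>S\<in>Pow {..<n}. if S = {} then (2 ^ n) ^ card I else 0)"
    using pos by (intro sum.cong refl) (auto simp: fourier_one)
  also have "\<dots> = 2 ^ (n * card I)" by (simp add: power_mult)
  finally have "(\<Sum>S\<in>Pow {..<n}. fourier n (\<lambda>_. 1) S ^ card I) = 2 ^ (n * card I)" .
  moreover have "n * (card V - card I) + n * card I = n * card V"
    using le by (simp add: add_mult_distrib2[symmetric])
  then have "2 ^ (n * (card V - card I)) * 2 ^ (n * card I) = (2 ^ (n * card V) :: real)"
    by (simp add: power_add[symmetric])
  ultimately show ?thesis
    using sum_zsum_prod[OF assms(1,2), of n "\<lambda>_. 1"] by simp
qed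

text \<open>Pairwise independence of the zero-sum events. Equal size gives each of \<open>I\<close>
  and \<open>J\<close> an index outside the other; summing over the point at that index kills every
  nontrivial \<open>S\<close>, respectively \<open>T\<close>, so only the pair of trivial characters
  is left.\<close>

lemma sum_zsum_pair:
  assumes "finite V" "I \<subseteq> V" "J \<subseteq> V" "card I = card J" "I \<noteq> J"
  shows "(\<Sum>X\<in>V \<rightarrow>\<^sub>E cube n. of_bool (zsum n I X) * of_bool (zsum n J X))
    = (2 ^ (n * card V) / (2 ^ n) ^ 2 :: real)"
proof -
  have fin: "finite I" "finite J" using assms finite_subset by blast+
  obtain i where i: "i \<in> I" "i \<notin> J" using assms fin by (metis card_subset_eq subsetI)
  obtain j where j: "j \<in> J" "j \<notin> I" using assms fin by (metis card_subset_eq subsetI)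
  have inner: "(\<Sum>X\<in>V \<rightarrow>\<^sub>E cube n. (\<Prod>i\<in>I. chi S (X i)) * (\<Prod>i\<in>J. chi T (X i)))
      = (if S = {} \<and> T = {} then 2 ^ (n * card V) else 0)"
    if S: "S \<subseteq> {..<n}" and T: "T \<subseteq> {..<n}" for S T
  proof -
    let ?g = "\<lambda>i x. (if i \<in> I then chi S x else 1) * (if i \<in> J then chi T x else 1)"
    have "(\<Sum>X\<in>V \<rightarrow>\<^sub>E cube n. (\<Prod>i\<in>I. chi S (X i)) * (\<Prod>i\<in>J. chi T (X i)))
        = (\<Sum>X\<in>V \<rightarrow>\<^sub>E cube n. \<Prod>i\<in>V. ?g i (X i))"
      using assms by (intro sum.cong refl) (simp add: prod.distrib prod.If_cases Int_absorb1)
    also have "\<dots> = (\<Prod>i\<in>V. \<Sum>x\<in>cube n. ?g i x)"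
      using assms by (intro prod_sum_PiE[symmetric]) simp_all
    also have "\<dots> = (if S = {} \<and> T = {} then 2 ^ (n * card V) else 0)"
    proof (cases "S = {}")
      case True
      show ?thesis
      proof (cases "T = {}")
        case True
        then have "?g = (\<lambda>_ _. 1)" using \<open>S = {}\<close> by (simp add: chi_def fun_eq_iff)
        then have "?g i x = 1" for i x by metis
        then show ?thesis using True \<open>S = {}\<close> by (simp only:) (simp add: power_mult)
      next
        case False
        then show ?thesis
          using sum_cube_chi[OF T] j assms(1,3) by (intro trans[OF prod_zero]) (auto intro!: bexI[of _ j])
      qed
    next
      case False
      then show ?thesis
        using sum_cube_chi[OF S] i assms(1,2) by (intro trans[OF prod_zero]) (auto intro!: bexI[of _ i])
    qed
    finally show ?thesis .
  qed
  have "(\<Sum>X\<in>V \<rightarrow>\<^sub>E cube n. of_bool (zsum n I X) * of_bool (zsum n J X))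
     = (\<Sum>X\<in>V \<rightarrow>\<^sub>E cube n. \<Sum>S\<in>Pow {..<n}. \<Sum>T\<in>Pow {..<n}.
          (\<Prod>i\<in>I. chi S (X i)) * (\<Prod>i\<in>J. chi T (X i))) / (2 ^ n) ^ 2"
    by (simp add: of_bool_zsum sum_product sum_divide_distrib power2_eq_square)
  also have "\<dots> = (\<Sum>S\<in>Pow {..<n}. \<Sum>T\<in>Pow {..<n}. \<Sum>X\<in>V \<rightarrow>\<^sub>E cube n.
          (\<Prod>i\<in>I. chi S (X i)) * (\<Prod>i\<in>J. chi T (X i))) / (2 ^ n) ^ 2"
    by (subst sum.swap, subst (2) sum.swap) (rule refl)
  also have "\<dots> = (\<Sum>S\<in>Pow {..<n}. \<Sum>T\<in>Pow {..<n}. if S = {} \<and> T = {} then 2 ^ (n * card V) else 0) / (2 ^ n) ^ 2"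
    by (intro arg_cong2[of _ _ _ _ "(/)"] sum.cong refl inner) auto
  also have "(\<Sum>S\<in>Pow {..<n}. \<Sum>T\<in>Pow {..<n}. if S = {} \<and> T = {} then 2 ^ (n * card V) else 0)
      = (\<Sum>S\<in>Pow {..<n}. if S = {} then (\<Sum>T\<in>Pow {..<n}. if T = {} then 2 ^ (n * card V) else 0) else (0::real))"
    by (intro sum.cong refl) auto
  also have "\<dots> = 2 ^ (n * card V)"
    by simp
  finally show ?thesis .
qed

lemma parseval:
  "(\<Sum>S\<in>Pow {..<n}. fourier n F S ^ 2) = 2 ^ n * (\<Sum>x\<in>cube n. F x ^ 2)"
proof -
  have eq: "(\<Sum>S\<in>Pow {..<n}. chi S x * chi S y) = 2 ^ n * of_bool (x = y)"
    if "x \<in> cube n" "y \<in> cube n" for x y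
  proof -
    have "(\<Sum>S\<in>Pow {..<n}. chi S x * chi S y) = (\<Sum>S\<in>Pow {..<n}. \<Prod>i\<in>S. sg (x i + y i))"
      by (simp add: chi_def prod.distrib sg_add)
    also have "\<dots> = 2 ^ n * of_bool (\<forall>j<n. x j + y j = 0)"
      by (rule sum_characters)
    also have "(\<forall>j<n. x j + y j = 0) \<longleftrightarrow> x = y"
      using that unfolding cube_def bit_eq_iff_add[symmetric]
      by (auto intro: PiE_ext)
    finally show ?thesis .
  qed
  have "(\<Sum>S\<in>Pow {..<n}. fourier n F S ^ 2)
      = (\<Sum>S\<in>Pow {..<n}. \<Sum>x\<in>cube n. \<Sum>y\<in>cube n. F x * F y * (chi S x * chi S y))"
    by (simp add: fourier_def power2_eq_square sum_product mult_ac)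
  also have "\<dots> = (\<Sum>x\<in>cube n. \<Sum>y\<in>cube n. F x * F y * (\<Sum>S\<in>Pow {..<n}. chi S x * chi S y))"
    unfolding sum_distrib_left
    by (subst sum.swap, intro sum.cong refl, subst sum.swap) (rule refl)
  also have "\<dots> = (\<Sum>x\<in>cube n. \<Sum>y\<in>cube n. if y = x then 2 ^ n * F x ^ 2 else 0)"
    by (intro sum.cong refl) (auto simp: eq power2_eq_square)
  also have "\<dots> = 2 ^ n * (\<Sum>x\<in>cube n. F x ^ 2)"
    by (simp add: sum_distrib_left)
  finally show ?thesis .
qed

lemma real_card_filter:
  "finite A \<Longrightarrow> real (card {x \<in> A. P x}) = (\<Sum>x\<in>A. of_bool (P x))"
  by (subst sum.mono_neutral_cong_right[of A "{x \<in> A. P x}" _ "\<lambda>_. 1"]) auto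

text \<open>The coefficient at \<open>S\<close> is the number of agreements minus the number of
  disagreements with the linear function of \<open>S\<close>. There is no matching lower bound,
  since a far function may be close to the complement of a linear one.\<close>

lemma fourier_far:
  assumes far: "far_from \<epsilon> n f (Pol1 n)" and S: "S \<subseteq> {..<n}"
  shows "fourier n (\<lambda>x. sg (f x)) S \<le> (1 - 2 * \<epsilon>) * 2 ^ n"
proof -
  let ?g = "\<lambda>x\<in>cube n. \<Sum>i\<in>S. x i"
  let ?D = "{x \<in> cube n. f x \<noteq> ?g x}"
  have "?g \<in> Pol1 n" using S unfolding Pol1_def by blast
  then have D: "real (card ?D) \<ge> \<epsilon> * 2 ^ n" using far unfolding far_from_def by blast
  have "sg (f x) * chi S x = 1 - 2 * of_bool (x \<in> ?D)" if "x \<in> cube n" for x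
  proof -
    have "chi S x = sg (?g x)" using that by (simp add: chi_def sg_sum)
    then show ?thesis using that by (cases "f x"; cases "?g x") simp_all
  qed
  then have "fourier n (\<lambda>x. sg (f x)) S = (\<Sum>x\<in>cube n. 1 - 2 * of_bool (x \<in> ?D))"
    unfolding fourier_def by (intro sum.cong) auto
  also have "\<dots> = 2 ^ n - 2 * (\<Sum>x\<in>cube n. of_bool (x \<in> ?D))"
    by (simp add: sum_subtractf sum_distrib_left)
  also have "(\<Sum>x\<in>cube n. of_bool (x \<in> ?D)) = real (card ?D)"
    by (subst real_card_filter) (auto intro!: sum.cong)
  finally show ?thesis using D by (simp add: algebra_simps)
qed

text \<open>Two of the \<open>k\<close> factors are summed by Parseval, the other
  \<open>k - 2\<close> are bounded by \<open>fourier_far\<close>. As \<open>k - 2\<close> is odd,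
  its power is monotone at negative coefficients too, whose absolute value is not
  controlled.\<close>

lemma fourier_far_power_sum:
  assumes far: "far_from \<epsilon> n f (Pol1 n)" and "\<epsilon> < 1 / 2" and k: "odd k" "k \<ge> 2"
  shows "(\<Sum>S\<in>Pow {..<n}. fourier n (\<lambda>x. sg (f x)) S ^ k) \<le> (1 - 2 * \<epsilon>) ^ (k - 2) * (2 ^ n) ^ k"
proof -
  let ?F = "fourier n (\<lambda>x. sg (f x))"
  let ?B = "((1 - 2 * \<epsilon>) * 2 ^ n) ^ (k - 2)"
  have "?F S ^ k \<le> ?F S ^ 2 * ?B" if "S \<in> Pow {..<n}" for S
  proof -
    have "?F S ^ (k - 2) \<le> ?B"
      using fourier_far[OF far, of S] that k by (intro power_mono_odd) auto
    then have "?F S ^ 2 * ?F S ^ (k - 2) \<le> ?F S ^ 2 * ?B"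
      by (intro mult_left_mono) auto
    moreover have "?F S ^ 2 * ?F S ^ (k - 2) = ?F S ^ k"
      using k by (metis le_add_diff_inverse power_add)
    ultimately show ?thesis by simp
  qed
  then have "(\<Sum>S\<in>Pow {..<n}. ?F S ^ k) \<le> (\<Sum>S\<in>Pow {..<n}. ?F S ^ 2) * ?B"
    unfolding sum_distrib_right by (rule sum_mono)
  also have "(\<Sum>S\<in>Pow {..<n}. ?F S ^ 2) = (2 ^ n) ^ 2"
    unfolding parseval by (simp add: power2_eq_square)
  also have "(2 ^ n) ^ 2 * ?B = (1 - 2 * \<epsilon>) ^ (k - 2) * ((2 ^ n) ^ 2 * (2 ^ n) ^ (k - 2))"
    by (simp add: power_mult_distrib)
  also have "(2 ^ n) ^ 2 * (2 ^ n) ^ (k - 2) = ((2 ^ n) ^ k :: real)"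
    using k by (metis le_add_diff_inverse power_add)
  finally show ?thesis .
qed

section \<open>Lower bound\<close>

text \<open>For finite \<open>U\<close> this says that any at most \<open>q\<close> distinct points
  of \<open>U\<close> are linearly independent over the field with two elements.\<close>

definition zsum_free :: "nat \<Rightarrow> nat \<Rightarrow> point set \<Rightarrow> bool"
  where "zsum_free n q U \<longleftrightarrow> (\<forall>T\<subseteq>U. T \<noteq> {} \<and> card T \<le> q \<longrightarrow> \<not> zsum n T (\<lambda>x. x))"

lemma finite_samples [simp]: "finite (samples n u)"
  unfolding samples_def by (rule finite_subset[of _ "Pow (cube n)"]) auto

lemma card_samples: "card (samples n u) = (2 ^ n) choose u"
  unfolding samples_def by (simp add: n_subsets)

lemma bit_add_eq_iff: "(c::bit) + a = b \<longleftrightarrow> a + (c + b) = 0"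
  by (cases a; cases b; cases c) simp_all

text \<open>Each agreement indicator is \<open>(chi S x * sg (c + \<sigma> x) + 1) / 2\<close>.
  Multiplied out over the subsets \<open>T\<close> of \<open>Q\<close> and summed over
  \<open>S\<close>, only \<open>T = {}\<close> survives, as no other subset sums to zero. The result
  depends on neither \<open>c\<close> nor \<open>\<sigma>\<close>: the answers are uniform
  bits.\<close>

lemma sum_affine_agree:
  assumes "finite Q" and ind: "\<And>T. T \<subseteq> Q \<Longrightarrow> T \<noteq> {} \<Longrightarrow> \<not> zsum n T (\<lambda>x. x)"
  shows "(\<Sum>S\<in>Pow {..<n}. \<Prod>x\<in>Q. of_bool (c + (\<Sum>i\<in>S. x i) = \<sigma> x)) = (2 ^ n / 2 ^ card Q :: real)"
proof -
  have bool: "of_bool (c + (\<Sum>i\<in>S. x i) = \<sigma> x) = (chi S x * sg (c + \<sigma> x) + 1) / 2" for S x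
    by (subst bit_add_eq_iff) (simp add: of_bool_bit sg_add chi_def sg_sum)
  have "(\<Sum>S\<in>Pow {..<n}. \<Prod>x\<in>Q. of_bool (c + (\<Sum>i\<in>S. x i) = \<sigma> x))
      = (\<Sum>S\<in>Pow {..<n}. \<Sum>T\<in>Pow Q. (\<Prod>x\<in>T. chi S x) * (\<Prod>x\<in>T. sg (c + \<sigma> x))) / 2 ^ card Q"
    using assms(1)
    by (simp add: bool prod_dividef prod_add prod.distrib sum_divide_distrib)
  also have "(\<Sum>S\<in>Pow {..<n}. \<Sum>T\<in>Pow Q. (\<Prod>x\<in>T. chi S x) * (\<Prod>x\<in>T. sg (c + \<sigma> x)))
      = (\<Sum>T\<in>Pow Q. (2 ^ n * of_bool (zsum n T (\<lambda>x. x))) * (\<Prod>x\<in>T. sg (c + \<sigma> x)))"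
    by (subst sum.swap) (simp add: of_bool_zsum sum_distrib_right)
  also have "\<dots> = (\<Sum>T\<in>Pow Q. if T = {} then 2 ^ n else 0)"
    using ind by (intro sum.cong refl) (auto simp: zsum_def)
  also have "\<dots> = 2 ^ n" using assms(1) by simp
  finally show ?thesis .
qed

text \<open>
  \<open>Q\<close> and \<open>\<sigma>\<close> record the answers already seen on the way to the subtree \<open>t\<close>.
\<close>

lemma sum_run_eq_if_marginals_eq:
  fixes h h' :: "'s \<Rightarrow> 'a \<Rightarrow> bit"
  assumes marg: "\<And>Q \<sigma>. Q \<subseteq> U \<Longrightarrow> finite Q \<Longrightarrow> card Q \<le> q \<Longrightarrow>
      (\<Sum>s\<in>K. \<Prod>x\<in>Q. of_bool (h s x = \<sigma> x)) = (\<Sum>s\<in>K. \<Prod>x\<in>Q. of_bool (h' s x = \<sigma> x) :: real)"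
    and "queries t \<subseteq> U" "Q \<subseteq> U" "finite Q" "card Q + depth t \<le> q"
  shows "(\<Sum>s\<in>K. (\<Prod>x\<in>Q. of_bool (h s x = \<sigma> x)) * of_bool (run (h s) t))
    = (\<Sum>s\<in>K. (\<Prod>x\<in>Q. of_bool (h' s x = \<sigma> x)) * of_bool (run (h' s) t) :: real)"
  using assms(2-)
proof (induction t arbitrary: Q \<sigma>)
  case (Decide b)
  then show ?case using marg[of Q \<sigma>] by (cases b) simp_all
next
  case (Query x t0 t1)
  show ?case
  proof (cases "x \<in> Q")
    case True
    \<comment> \<open>A repeated query reveals nothing new: unless the product vanishes, the answer
      is \<open>\<sigma> x\<close>, and the run continues in one fixed subtree.\<close>
    have known: "(\<Prod>y\<in>Q. of_bool (g y = \<sigma> y)) * of_bool (run g (Query x t0 t1))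
        = ((\<Prod>y\<in>Q. of_bool (g y = \<sigma> y)) * of_bool (run g (if \<sigma> x = 0 then t0 else t1)) :: real)" for g
    proof (cases "g x = \<sigma> x")
      case False
      then have "(\<Prod>y\<in>Q. of_bool (g y = \<sigma> y)) = (0::real)"
        using True Query.prems by (intro prod_zero) (auto intro!: bexI[of _ x])
      then show ?thesis by simp
    qed simp
    show ?thesis
      using Query.IH(1)[of Q \<sigma>] Query.IH(2)[of Q \<sigma>] Query.prems
      unfolding known by (cases "\<sigma> x") simp_all
  next
    case False
    \<comment> \<open>Splitting by the answer moves \<open>x\<close> from the tree into
      \<open>Q\<close>: the depth drops as \<open>card Q\<close> grows, so the budget
      \<open>q\<close> is respected.\<close>
    have split: "(\<Prod>y\<in>Q. of_bool (g y = \<sigma> y)) * of_bool (run g (Query x t0 t1))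
        = (\<Prod>y\<in>insert x Q. of_bool (g y = (\<sigma>(x := 0)) y)) * of_bool (run g t0)
        + (\<Prod>y\<in>insert x Q. of_bool (g y = (\<sigma>(x := 1)) y)) * (of_bool (run g t1) :: real)" (is "?l g = ?r g") for g
    proof -
      have "(\<Prod>y\<in>Q. of_bool (g y = (\<sigma>(x := b)) y)) = (\<Prod>y\<in>Q. of_bool (g y = \<sigma> y) :: real)" for b
        using False by (intro prod.cong) auto
      then show ?thesis using False Query.prems by (cases "g x") simp_all
    qed
    have "(\<Sum>s\<in>K. ?r (h s)) = (\<Sum>s\<in>K. ?r (h' s))"
      using Query.IH(1)[of "insert x Q" "\<sigma>(x := 0)"] Query.IH(2)[of "insert x Q" "\<sigma>(x := 1)"]
        Query.prems False unfolding sum.distrib by simp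
    then show ?thesis unfolding split .
  qed
qed

lemma pmf_map_run: "pmf (map_pmf (run f) M) True = measure_pmf.expectation M (\<lambda>t. of_bool (run f t))"
proof -
  have "pmf (map_pmf (run f) M) True = measure_pmf.prob M {t. run f t}"
    by (simp add: pmf_map vimage_def)
  also have "\<dots> = measure_pmf.expectation M (indicator {t. run f t})"
    by simp
  also have "indicator {t. run f t} = (\<lambda>t. of_bool (run f t) :: real)"
    by (auto simp: indicator_def)
  finally show ?thesis .
qed

lemma pmf_bool_False: "pmf M False = 1 - pmf (M :: bool pmf) True"
proof -
  have "pmf M True + pmf M False = 1"
    using sum_pmf_eq_1[of UNIV M, OF _ subset_UNIV] by (simp add: UNIV_bool)
  then show ?thesis by simp
qed

section \<open>Short dependencies in a random sample\<close>

text \<open>The quotient of the two binomials is the probability that a random \<open>u\<close>-set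
  contains \<open>j\<close> given points. Each further point contributes a factor
  \<open>(u - j) / (N - j)\<close>, which is at most \<open>u / N\<close>.\<close>

lemma choose_shift_le:
  assumes "u \<le> N" "j \<le> u"
  shows "real ((N - j) choose (u - j)) * real N ^ j \<le> real u ^ j * real (N choose u)"
  using assms(2)
proof (induction j)
  case (Suc j)
  let ?c = "\<lambda>j. real ((N - j) choose (u - j))"
  have "(u - j) * ((N - j) choose (u - j)) = (N - j) * ((N - Suc j) choose (u - Suc j))"
    using binomial_absorption[of "u - Suc j" "N - j"] Suc.prems by (simp add: Suc_diff_Suc)
  then have eq: "real (u - j) * ?c j = real (N - j) * ?c (Suc j)"
    by (metis of_nat_mult)
  have pos: "real (N - j) > 0" using Suc.prems assms by simp
  have "real (u - j) * real N \<le> real u * real (N - j)"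
    using Suc.prems assms mult_left_mono[of "real u" "real N" "real j"]
    by (simp add: of_nat_diff algebra_simps)
  then have "real (u - j) * real N * ?c j \<le> real u * real (N - j) * ?c j"
    by (rule mult_right_mono) simp
  also have "real (u - j) * real N * ?c j = (real (u - j) * ?c j) * real N"
    by (simp add: mult_ac)
  finally have "real (N - j) * (?c (Suc j) * real N) \<le> real (N - j) * (real u * ?c j)"
    by (simp add: eq mult_ac)
  then have "?c (Suc j) * real N \<le> real u * ?c j" using pos by simp
  then have "?c (Suc j) * real N * real N ^ j \<le> real u * ?c j * real N ^ j"
    by (rule mult_right_mono) simp
  also have "\<dots> \<le> real u * (real u ^ j * real (N choose u))"
    using mult_left_mono[OF Suc.IH, of "real u"] Suc.prems by (simp add: mult_ac)
  finally show ?case by (simp add: mult_ac)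
qed simp

lemma card_supersets:
  assumes "finite C" "T \<subseteq> C" "card T \<le> u"
  shows "card {U. U \<subseteq> C \<and> card U = u \<and> T \<subseteq> U} = (card C - card T) choose (u - card T)"
proof -
  have fin: "finite T" using assms finite_subset by blast
  have "bij_betw (\<lambda>V. V \<union> T) {V. V \<subseteq> C - T \<and> card V = u - card T} {U. U \<subseteq> C \<and> card U = u \<and> T \<subseteq> U}"
  proof (rule bij_betw_byWitness[where f' = "\<lambda>U. U - T"])
    show "(\<lambda>V. V \<union> T) ` {V. V \<subseteq> C - T \<and> card V = u - card T} \<subseteq> {U. U \<subseteq> C \<and> card U = u \<and> T \<subseteq> U}"
    proof clarsimp
      fix V assume V: "V \<subseteq> C - T" "card V = u - card T"
      moreover have "finite V" using V assms finite_subset by blast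
      moreover have "V \<inter> T = {}" using V by auto
      ultimately show "V \<subseteq> C \<and> T \<subseteq> C \<and> card (V \<union> T) = u"
        using assms fin by (auto simp: card_Un_disjoint)
    qed
    show "(\<lambda>U. U - T) ` {U. U \<subseteq> C \<and> card U = u \<and> T \<subseteq> U} \<subseteq> {V. V \<subseteq> C - T \<and> card V = u - card T}"
      using fin by (auto simp: card_Diff_subset)
  qed auto
  then have "card {U. U \<subseteq> C \<and> card U = u \<and> T \<subseteq> U} = card {V. V \<subseteq> C - T \<and> card V = u - card T}"
    by (rule bij_betw_same_card[symmetric])
  also have "\<dots> = (card C - card T) choose (u - card T)"
    using assms fin by (simp add: n_subsets card_Diff_subset)
  finally show ?thesis .
qed

text \<open>Enumerating such a set gives a zero-sum \<open>j\<close>-tuple with that range, so the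
  number of these tuples, known from \<open>sum_zsum\<close>, is a bound.\<close>

lemma card_zsum_sets:
  assumes "j > 0"
  shows "real (card {T. T \<subseteq> cube n \<and> card T = j \<and> zsum n T (\<lambda>x. x)}) \<le> (2 ^ n) ^ j / 2 ^ n"
    (is "real (card ?Z) \<le> _")
proof -
  let ?P = "{..<j} \<rightarrow>\<^sub>E cube n"
  let ?X = "{X \<in> ?P. zsum n {..<j} X}"
  have fin: "finite ?P" by (intro finite_PiE) simp_all
  have "?Z \<subseteq> (\<lambda>X. X ` {..<j}) ` ?X"
  proof
    fix T assume T: "T \<in> ?Z"
    then have "finite T" using finite_subset finite_cube by blast
    then obtain h where h: "bij_betw h {..<j} T"
      using T ex_bij_betw_nat_finite[of T] by (auto simp: atLeast0LessThan)
    let ?h = "restrict h {..<j}"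
    have "zsum n {..<j} ?h"
      unfolding zsum_def
    proof (intro allI impI)
      fix i assume "i < n"
      then have "(\<Sum>x\<in>T. x i) = 0" using T by (simp add: zsum_def)
      moreover have "(\<Sum>l<j. h l i) = (\<Sum>x\<in>T. x i)"
        by (rule sum.reindex_bij_betw[OF h])
      ultimately show "(\<Sum>l<j. ?h l i) = 0" by simp
    qed
    moreover have "?h \<in> ?P" using h T by (auto simp: bij_betw_def)
    moreover have "?h ` {..<j} = T" using h by (simp add: bij_betw_def)
    ultimately show "T \<in> (\<lambda>X. X ` {..<j}) ` ?X" by blast
  qed
  then have "card ?Z \<le> card ((\<lambda>X. X ` {..<j}) ` ?X)"
    using fin by (intro card_mono) auto
  also have "\<dots> \<le> card ?X" using fin by (intro card_image_le) auto
  finally have "card ?Z \<le> card ?X" .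
  moreover have "real (card ?X) = (\<Sum>X\<in>?P. of_bool (zsum n {..<j} X))"
    using fin by (rule real_card_filter)
  ultimately show ?thesis
    using sum_zsum[of "{..<j}" "{..<j}" n] assms by (simp add: power_mult lessThan_empty_iff)
qed

text \<open>Union bound over the sizes \<open>j\<close> from 1 to \<open>q\<close> and the zero-sum
  sets of size \<open>j\<close>: there are at most \<open>(2 ^ n) ^ j / 2 ^ n\<close> of them, and
  each lies in a random sample with probability at most \<open>(u / 2 ^ n) ^ j\<close>.\<close>

lemma card_not_zsum_free:
  assumes u: "u \<le> 2 ^ n" "u \<ge> 1"
  shows "real (card {U \<in> samples n u. \<not> zsum_free n q U})
    \<le> real q * real u ^ q / 2 ^ n * real (card (samples n u))"
proof -
  let ?Z = "\<lambda>j. {T. T \<subseteq> cube n \<and> card T = j \<and> zsum n T (\<lambda>x. x)}"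
  let ?S = "\<lambda>T. {U. U \<subseteq> cube n \<and> card U = u \<and> T \<subseteq> U}"
  let ?N = "2 ^ n :: real"
  have finZ: "finite (?Z j)" for j
    by (rule finite_subset[of _ "Pow (cube n)"]) auto
  have S: "real (card (?S T)) * ?N ^ j \<le> real u ^ j * real (card (samples n u))" if "T \<in> ?Z j" for T j
  proof (cases "j \<le> u")
    case True
    then show ?thesis
      using card_supersets[of "cube n" T u] choose_shift_le[of u "2 ^ n" j] u that
      by (simp add: card_samples)
  next
    case False
    have "?S T = {}"
      using False that by (auto dest: card_mono[OF finite_subset[OF _ finite_cube]])
    then show ?thesis by (simp only:) simp
  qed
  have sub: "{U \<in> samples n u. \<not> zsum_free n q U} \<subseteq> (\<Union>j\<in>{1..q}. \<Union>T\<in>?Z j. ?S T)"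
  proof
    fix U assume U: "U \<in> {U \<in> samples n u. \<not> zsum_free n q U}"
    then obtain T where T: "T \<subseteq> U" "T \<noteq> {}" "card T \<le> q" "zsum n T (\<lambda>x. x)"
      unfolding zsum_free_def by blast
    have "finite T" using T U unfolding samples_def
      by (metis (no_types, lifting) finite_cube finite_subset mem_Collect_eq)
    then have "card T \<in> {1..q}" using T by (simp add: Suc_le_eq card_gt_0_iff)
    moreover have "T \<in> ?Z (card T)" "U \<in> ?S T" using T U unfolding samples_def by auto
    ultimately show "U \<in> (\<Union>j\<in>{1..q}. \<Union>T\<in>?Z j. ?S T)" by blast
  qed
  have finS: "finite (?S T)" for T
    by (rule finite_subset[of _ "Pow (cube n)"]) auto
  have "real (card {U \<in> samples n u. \<not> zsum_free n q U}) \<le> real (card (\<Union>j\<in>{1..q}. \<Union>T\<in>?Z j. ?S T))"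
    using sub finS finZ by (intro of_nat_mono card_mono) auto
  also have "\<dots> \<le> (\<Sum>j\<in>{1..q}. real (card (\<Union>T\<in>?Z j. ?S T)))"
    unfolding of_nat_sum[symmetric] by (intro of_nat_mono card_UN_le) simp
  also have "\<dots> \<le> (\<Sum>j\<in>{1..q}. real u ^ q / ?N * real (card (samples n u)))"
  proof (rule sum_mono)
    fix j assume j: "j \<in> {1..q}"
    have "real (card (\<Union>T\<in>?Z j. ?S T)) \<le> (\<Sum>T\<in>?Z j. real (card (?S T)))"
      unfolding of_nat_sum[symmetric] by (intro of_nat_mono card_UN_le finZ)
    also have "\<dots> \<le> (\<Sum>T\<in>?Z j. real u ^ j * real (card (samples n u)) / ?N ^ j)"
    proof (rule sum_mono)
      fix T assume "T \<in> ?Z j"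
      from S[OF this] show "real (card (?S T)) \<le> real u ^ j * real (card (samples n u)) / ?N ^ j"
        by (subst pos_le_divide_eq) simp_all
    qed
    also have "\<dots> = real (card (?Z j)) * (real u ^ j * real (card (samples n u)) / ?N ^ j)"
      by simp
    also have "\<dots> \<le> ?N ^ j / ?N * (real u ^ j * real (card (samples n u)) / ?N ^ j)"
      using card_zsum_sets[of j n] j by (intro mult_right_mono) auto
    also have "\<dots> = real u ^ j / ?N * real (card (samples n u))"
      by simp
    also have "\<dots> \<le> real u ^ q / ?N * real (card (samples n u))"
      using u j by (intro mult_right_mono divide_right_mono power_increasing) auto
    finally show "real (card (\<Union>T\<in>?Z j. ?S T)) \<le> real u ^ q / ?N * real (card (samples n u))" .
  qed
  finally show ?thesis by simp
qed

section \<open>Distinguishing linear functions from their complements\<close>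

text \<open>The signs of the two functions multiply to minus the character of the symmetric
  difference \<open>?R\<close>. That character sums to zero or is constantly 1, so the functions
  differ on half of the cube or on all of it.\<close>

lemma far_from_complement_linear:
  assumes "\<epsilon> < 1 / 2" "S \<subseteq> {..<n}"
  shows "far_from \<epsilon> n (\<lambda>x\<in>cube n. 1 + (\<Sum>i\<in>S. x i)) (Pol1 n)"
  unfolding far_from_def
proof
  let ?f = "\<lambda>x\<in>cube n. 1 + (\<Sum>i\<in>S. x i)"
  fix g assume "g \<in> Pol1 n"
  then obtain T where T: "T \<subseteq> {..<n}" and g: "g = (\<lambda>x\<in>cube n. \<Sum>i\<in>T. x i)"
    unfolding Pol1_def by blast
  let ?R = "(S - T) \<union> (T - S)"
  have chi: "sg (?f x) * sg (g x) = - chi ?R x" if x: "x \<in> cube n" for x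
  proof -
    have fin: "finite S" "finite T" using assms T finite_subset by blast+
    have "chi S x = chi (S \<inter> T) x * chi (S - T) x"
      unfolding chi_def using fin(1) by (rule prod.Int_Diff)
    moreover have "chi T x = chi (S \<inter> T) x * chi (T - S) x"
      unfolding chi_def Int_commute[of S T] using fin(2) by (rule prod.Int_Diff)
    moreover have "chi ?R x = chi (S - T) x * chi (T - S) x"
      unfolding chi_def using fin by (intro prod.union_disjoint) auto
    moreover have "chi (S \<inter> T) x * chi (S \<inter> T) x = 1"
      by (simp add: chi_def prod.distrib[symmetric])
    ultimately have "chi S x * chi T x = chi ?R x"
      by (metis mult.assoc mult.commute mult.right_neutral)
    then show ?thesis using x by (simp add: g sg_add sg_sum chi_def)
  qed
  have "real (card {x \<in> cube n. ?f x \<noteq> g x}) = (\<Sum>x\<in>cube n. of_bool (?f x \<noteq> g x))"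
    by (simp only: real_card_filter finite_cube)
  also have "\<dots> = (\<Sum>x\<in>cube n. (1 + chi ?R x) / 2)"
  proof (rule sum.cong)
    fix x assume "x \<in> cube n"
    then show "of_bool (?f x \<noteq> g x) = (1 + chi ?R x) / 2"
      using chi[of x] by (cases "?f x"; cases "g x") simp_all
  qed simp
  also have "\<dots> = (2 ^ n + (\<Sum>x\<in>cube n. chi ?R x)) / 2"
    by (simp add: sum_divide_distrib[symmetric] sum.distrib)
  also have "\<dots> \<ge> 2 ^ n / 2"
  proof -
    have "?R \<subseteq> {..<n}" using assms(2) T by blast
    then show ?thesis by (simp only: sum_cube_chi) simp
  qed
  finally have "2 ^ n / 2 \<le> real (card {x \<in> cube n. ?f x \<noteq> g x})" .
  moreover have "\<epsilon> * 2 ^ n \<le> 2 ^ n / 2"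
    using assms(1) mult_right_mono[of \<epsilon> "1 / 2" "2 ^ n"] by simp
  ultimately show "\<epsilon> * 2 ^ n \<le> real (card {x \<in> cube n. ?f x \<noteq> g x})"
    by linarith
qed

text \<open>Let \<open>d U\<close> be the advantage in accepting linear functions over their
  complements on the sample \<open>U\<close>, added up over all \<open>S\<close>. Correctness forces
  its mean over \<open>U\<close> to be at least \<open>2 ^ n / 3\<close>. But \<open>d U\<close> is
  0 on \<open>zsum_free\<close> samples and at most \<open>2 ^ n\<close> on the others, so the
  latter have probability at least \<open>1 / 3\<close>.\<close>

lemma tester_lower_bound:
  assumes "\<epsilon> < 1 / 2" and u: "u \<le> 2 ^ n" "u \<ge> 1"
    and tester: "tester \<epsilon> n (Pol1 n) u q A"
  shows "1 / 3 \<le> real q * real u ^ q / 2 ^ n"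
proof -
  let ?K = "Pow {..<n}"
  let ?h = "\<lambda>c S. \<lambda>x\<in>cube n. c + (\<Sum>i\<in>S. x i)"
  let ?acc = "\<lambda>c S U. pmf (map_pmf (run (?h c S)) (A U)) True"
  let ?Sa = "samples n u"
  have card_pos: "card ?Sa > 0"
    using u by (simp add: card_samples)
  then have ne: "?Sa \<noteq> {}" by auto
  have out: "pmf (outcome n u A (?h c S)) True = (\<Sum>U\<in>?Sa. ?acc c S U) / card ?Sa" for c S
    unfolding outcome_def using ne by (simp add: pmf_bind_pmf_of_set)
  have "?h 0 S \<in> Pol1 n" if "S \<in> ?K" for S
    using that unfolding Pol1_def by auto
  then have lin: "2 / 3 \<le> (\<Sum>U\<in>?Sa. ?acc 0 S U) / card ?Sa" if "S \<in> ?K" for S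
    using tester that unfolding tester_def out[symmetric] by blast
  have "?h 1 S \<in> boolean_functions n" for S
    unfolding boolean_functions_def by auto
  then have "2 / 3 \<le> pmf (outcome n u A (?h 1 S)) False" if "S \<in> ?K" for S
    using tester that far_from_complement_linear[OF assms(1), of S n] unfolding tester_def by blast
  then have aff: "(\<Sum>U\<in>?Sa. ?acc 1 S U) / card ?Sa \<le> 1 / 3" if "S \<in> ?K" for S
    using that unfolding out[symmetric] pmf_bool_False by fastforce
  define d where "d U = (\<Sum>S\<in>?K. ?acc 0 S U - ?acc 1 S U)" for U
  have free: "d U = 0" if U: "U \<in> ?Sa" "zsum_free n q U" for U
  proof -
    have marg: "(\<Sum>S\<in>?K. \<Prod>x\<in>Q. of_bool (?h c S x = \<sigma> x)) = (2 ^ n / 2 ^ card Q :: real)"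
      if Q: "Q \<subseteq> U" "finite Q" "card Q \<le> q" for Q \<sigma> c
    proof -
      have "Q \<subseteq> cube n" using Q U unfolding samples_def by blast
      then have "(\<Sum>S\<in>?K. \<Prod>x\<in>Q. of_bool (?h c S x = \<sigma> x))
          = (\<Sum>S\<in>?K. \<Prod>x\<in>Q. of_bool (c + (\<Sum>i\<in>S. x i) = \<sigma> x) :: real)"
        by (intro sum.cong prod.cong refl) auto
      also have "\<dots> = 2 ^ n / 2 ^ card Q"
      proof (rule sum_affine_agree[OF Q(2)])
        fix T assume "T \<subseteq> Q" "T \<noteq> {}"
        moreover from this have "card T \<le> q" using Q card_mono[OF Q(2), of T] by simp
        ultimately show "\<not> zsum n T (\<lambda>x. x)" using U Q unfolding zsum_free_def by blast
      qed
      finally show ?thesis .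
    qed
    have runs: "(\<Sum>S\<in>?K. of_bool (run (?h 0 S) t)) = (\<Sum>S\<in>?K. of_bool (run (?h 1 S) t) :: real)"
      if t: "t \<in> set_pmf (A U)" for t
    proof -
      have t: "queries t \<subseteq> U" "depth t \<le> q"
        using tester U t unfolding tester_def by blast+
      \<comment> \<open>At the root no answer has been recorded yet, so the induction over trees is
        applied with \<open>Q = {}\<close>.\<close>
      have "(\<Sum>S\<in>?K. (\<Prod>x\<in>{}. of_bool (?h 0 S x = 0)) * of_bool (run (?h 0 S) t))
          = (\<Sum>S\<in>?K. (\<Prod>x\<in>{}. of_bool (?h 1 S x = 0)) * of_bool (run (?h 1 S) t) :: real)"
        using t by (intro sum_run_eq_if_marginals_eq[where U = U and q = q]) (simp_all only: marg, simp_all)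
      then show ?thesis by (simp only: prod.empty mult_1)
    qed
    have int: "integrable (measure_pmf (A U)) (\<lambda>t. of_bool (run f t) :: real)" for f
      by (rule measure_pmf.integrable_const_bound[of _ 1]) auto
    have "(\<Sum>S\<in>?K. ?acc c S U) = measure_pmf.expectation (A U) (\<lambda>t. \<Sum>S\<in>?K. of_bool (run (?h c S) t))" for c
      unfolding pmf_map_run by (subst Bochner_Integration.integral_sum) (simp_all add: int)
    moreover have "measure_pmf.expectation (A U) (\<lambda>t. \<Sum>S\<in>?K. of_bool (run (?h 0 S) t) :: real)
        = measure_pmf.expectation (A U) (\<lambda>t. \<Sum>S\<in>?K. of_bool (run (?h 1 S) t))"
      using runs by (intro integral_cong_AE) (auto simp: AE_measure_pmf_iff)
    ultimately have "(\<Sum>S\<in>?K. ?acc 0 S U) = (\<Sum>S\<in>?K. ?acc 1 S U)"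
      by (simp only:)
    then show ?thesis unfolding d_def sum_subtractf by (simp only: diff_self)
  qed
  have d_le: "d U \<le> 2 ^ n" for U
  proof -
    have "d U \<le> (\<Sum>S\<in>?K. 1)"
      unfolding d_def
    proof (rule sum_mono)
      fix S show "?acc 0 S U - ?acc 1 S U \<le> 1"
        using pmf_le_1[of "map_pmf (run (?h 0 S)) (A U)" True] pmf_nonneg[of "map_pmf (run (?h 1 S)) (A U)" True]
        by linarith
    qed
    then show ?thesis by (simp add: card_Pow)
  qed
  have "(\<Sum>U\<in>?Sa. d U) \<le> (\<Sum>U\<in>?Sa. 2 ^ n * of_bool (\<not> zsum_free n q U))"
    using free d_le by (intro sum_mono) (auto split: split_of_bool)
  also have "\<dots> = 2 ^ n * real (card {U \<in> ?Sa. \<not> zsum_free n q U})"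
    by (simp only: sum_distrib_left[symmetric] real_card_filter finite_samples)
  also have "\<dots> \<le> 2 ^ n * (real q * real u ^ q / 2 ^ n * real (card ?Sa))"
    by (intro mult_left_mono card_not_zsum_free u) simp
  finally have sum_d: "(\<Sum>U\<in>?Sa. d U) \<le> 2 ^ n * (real q * real u ^ q / 2 ^ n * real (card ?Sa))" .
  have "2 ^ n * (1 / 3) = (\<Sum>S\<in>?K. 1 / 3 :: real)"
    by (simp add: card_Pow)
  also have "\<dots> \<le> (\<Sum>S\<in>?K. (\<Sum>U\<in>?Sa. ?acc 0 S U) / card ?Sa - (\<Sum>U\<in>?Sa. ?acc 1 S U) / card ?Sa)"
  proof (rule sum_mono)
    fix S assume "S \<in> ?K"
    then show "1 / 3 \<le> (\<Sum>U\<in>?Sa. ?acc 0 S U) / card ?Sa - (\<Sum>U\<in>?Sa. ?acc 1 S U) / card ?Sa"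
      using lin[of S] aff[of S] by linarith
  qed
  also have "\<dots> = (\<Sum>S\<in>?K. \<Sum>U\<in>?Sa. ?acc 0 S U - ?acc 1 S U) / card ?Sa"
    by (simp only: diff_divide_distrib[symmetric] sum_subtractf[symmetric] sum_divide_distrib[symmetric])
  also have "\<dots> = (\<Sum>U\<in>?Sa. d U) / card ?Sa"
    unfolding d_def by (subst sum.swap) (rule refl)
  also have "\<dots> \<le> 2 ^ n * (real q * real u ^ q / 2 ^ n * real (card ?Sa)) / card ?Sa"
    by (intro divide_right_mono sum_d) simp
  also have "\<dots> = 2 ^ n * (real q * real u ^ q / 2 ^ n)"
    using card_pos ne by simp
  finally have "2 ^ n * (1 / 3) \<le> 2 ^ n * (real q * real u ^ q / 2 ^ n)" .
  then show ?thesis by (simp only: mult_le_cancel_left_pos zero_less_power zero_less_numeral)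
qed

section \<open>Upper bound\<close>

text \<open>The bit \<open>b\<close> carries the parity of the answers so far. Even parity continues
  with \<open>t\<close>, which allows two checks to be chained.\<close>

primrec parity_tree :: "'a list \<Rightarrow> bit \<Rightarrow> 'a dtree \<Rightarrow> 'a dtree" where
  "parity_tree [] b t = (if b = 0 then t else Decide False)"
| "parity_tree (x # xs) b t = Query x (parity_tree xs b t) (parity_tree xs (b + 1) t)"

lemma run_parity_tree:
  "run f (parity_tree xs b t) \<longleftrightarrow> b + sum_list (map f xs) = 0 \<and> run f t"
proof (induction xs arbitrary: b)
  case (Cons x xs)
  then show ?case by (cases "f x") (simp_all add: add.assoc)
qed simp

lemma depth_parity_tree: "depth (parity_tree xs b t) \<le> length xs + depth t"
  by (induction xs arbitrary: b) simp_all

lemma queries_parity_tree: "queries (parity_tree xs b t) \<subseteq> set xs \<union> queries t"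
  by (induction xs arbitrary: b) auto

definition half :: "nat \<Rightarrow> bool \<Rightarrow> (bool \<times> nat \<Rightarrow> point) \<Rightarrow> nat \<Rightarrow> point"
  where "half v b X = (\<lambda>i\<in>{..<v}. X (b, i))"

definition dependencies :: "nat \<Rightarrow> nat \<Rightarrow> nat \<Rightarrow> (bool \<times> nat \<Rightarrow> point) \<Rightarrow> nat set set"
  where "dependencies n k v X =
    {I. I \<subseteq> {..<v} \<and> card I = k \<and> zsum n I (half v False X) \<and> zsum n I (half v True X)}"

definition parity_checks :: "nat \<Rightarrow> (bool \<times> nat \<Rightarrow> point) \<Rightarrow> nat set \<Rightarrow> point dtree"
  where "parity_checks v X I =
    parity_tree (map (half v False X) (sorted_list_of_set I)) 0
      (parity_tree (map (half v True X) (sorted_list_of_set I)) 0 (Decide True))"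

text \<open>Without a dependency the test accepts, so it never rejects a linear function. For far
  functions this is harmless, as the number of dependencies is concentrated around a large
  mean.\<close>

definition dependency_test :: "nat \<Rightarrow> nat \<Rightarrow> nat \<Rightarrow> (bool \<times> nat \<Rightarrow> point) \<Rightarrow> point dtree pmf"
  where "dependency_test n k v X = (if dependencies n k v X = {} then return_pmf (Decide True)
    else map_pmf (parity_checks v X) (pmf_of_set (dependencies n k v X)))"

lemma run_parity_checks:
  assumes "finite I"
  shows "run f (parity_checks v X I) \<longleftrightarrow>
    (\<Sum>i\<in>I. f (half v False X i)) = 0 \<and> (\<Sum>i\<in>I. f (half v True X i)) = 0"
  using assms
  by (simp add: parity_checks_def run_parity_tree comp_def sum_list_distinct_conv_sum_set)

lemma depth_parity_checks: "depth (parity_checks v X I) \<le> 2 * card I"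
  unfolding parity_checks_def
  by (rule order_trans[OF depth_parity_tree])
    (use depth_parity_tree[of "map (half v True X) (sorted_list_of_set I)" 0 "Decide True"] in simp)

lemma queries_parity_checks:
  assumes "I \<subseteq> {..<v}"
  shows "queries (parity_checks v X I) \<subseteq> X ` (UNIV \<times> {..<v})"
proof -
  have "finite I" using assms finite_subset by blast
  then have "queries (parity_checks v X I) \<subseteq> half v False X ` I \<union> half v True X ` I"
    unfolding parity_checks_def
    using queries_parity_tree[of "map (half v True X) (sorted_list_of_set I)" 0 "Decide True"]
    by (intro order_trans[OF queries_parity_tree]) auto
  also have "\<dots> \<subseteq> X ` (UNIV \<times> {..<v})"
    using assms by (auto simp: half_def)
  finally show ?thesis .
qed

lemma finite_dependencies [simp]: "finite (dependencies n k v X)"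
  unfolding dependencies_def by (rule finite_subset[of _ "Pow {..<v}"]) auto

lemma dependency_test_trees:
  assumes "t \<in> set_pmf (dependency_test n k v X)"
  shows "queries t \<subseteq> X ` (UNIV \<times> {..<v})" "depth t \<le> 2 * k"
proof -
  consider "t = Decide True" | I where "I \<in> dependencies n k v X" "t = parity_checks v X I"
    using assms by (auto simp: dependency_test_def split: if_splits)
  then have "queries t \<subseteq> X ` (UNIV \<times> {..<v}) \<and> depth t \<le> 2 * k"
  proof cases
    case (2 I)
    then have "I \<subseteq> {..<v}" "card I = k" by (simp_all add: dependencies_def)
    then show ?thesis
      using queries_parity_checks[of I v X] depth_parity_checks[of v X I] 2(2) by simp
  qed simp
  then show "queries t \<subseteq> X ` (UNIV \<times> {..<v})" "depth t \<le> 2 * k"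
    by blast+
qed

section \<open>Acceptance on independent uniform points\<close>

definition accept_prob :: "nat \<Rightarrow> nat \<Rightarrow> nat \<Rightarrow> (point \<Rightarrow> bit) \<Rightarrow> (bool \<times> nat \<Rightarrow> point) \<Rightarrow> real"
  where "accept_prob n k v f X = pmf (map_pmf (run f) (dependency_test n k v X)) True"

text \<open>The product form, needed for \<open>sum_ratio_le\<close>, also covers the case without
  dependencies, where both sides are 0.\<close>

lemma accept_prob_mult_card:
  "accept_prob n k v f X * real (card (dependencies n k v X))
    = real (card {I \<in> dependencies n k v X. run f (parity_checks v X I)})"
proof (cases "dependencies n k v X = {}")
  case False
  let ?D = "dependencies n k v X"
  have "accept_prob n k v f X = measure_pmf.prob (pmf_of_set ?D) {I. run f (parity_checks v X I)}"
    using False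
    by (simp add: accept_prob_def dependency_test_def pmf.map_comp pmf_map vimage_def comp_def)
  also have "\<dots> = real (card {I \<in> ?D. run f (parity_checks v X I)}) / real (card ?D)"
    using False by (simp add: measure_pmf_of_set Int_def)
  finally show ?thesis using False by (simp add: card_gt_0_iff)
qed simp

lemma sum_two_halves:
  fixes g h :: "(nat \<Rightarrow> point) \<Rightarrow> real"
  shows "(\<Sum>X\<in>(UNIV \<times> {..<v}) \<rightarrow>\<^sub>E C. g (half v False X) * h (half v True X))
    = (\<Sum>Y\<in>{..<v} \<rightarrow>\<^sub>E C. g Y) * (\<Sum>Y\<in>{..<v} \<rightarrow>\<^sub>E C. h Y)"
proof -
  let ?P = "{..<v} \<rightarrow>\<^sub>E C"
  have "(\<Sum>Y\<in>?P. g Y) * (\<Sum>Y\<in>?P. h Y) = (\<Sum>(Y, Z)\<in>?P \<times> ?P. g Y * h Z)"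
    by (simp add: sum_product sum.cartesian_product)
  also have "\<dots> = (\<Sum>X\<in>(UNIV \<times> {..<v}) \<rightarrow>\<^sub>E C. g (half v False X) * h (half v True X))"
  proof (rule sum.reindex_bij_witness[where
        i = "\<lambda>X. (half v False X, half v True X)" and
        j = "\<lambda>(Y, Z). \<lambda>(b, i)\<in>UNIV \<times> {..<v}. if b then Z i else Y i"])
    fix p assume p: "p \<in> ?P \<times> ?P"
    then obtain Y Z where YZ: "p = (Y, Z)" "Y \<in> ?P" "Z \<in> ?P" by auto
    let ?X = "\<lambda>(b, i)\<in>UNIV \<times> {..<v}. if b then Z i else Y i"
    have "half v False ?X = Y" "half v True ?X = Z"
      using YZ by (auto simp: half_def fun_eq_iff PiE_def extensional_def)
    then show "(half v False ((\<lambda>(Y, Z). \<lambda>(b, i)\<in>UNIV \<times> {..<v}. if b then Z i else Y i) p),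
        half v True ((\<lambda>(Y, Z). \<lambda>(b, i)\<in>UNIV \<times> {..<v}. if b then Z i else Y i) p)) = p"
      "g (half v False ((\<lambda>(Y, Z). \<lambda>(b, i)\<in>UNIV \<times> {..<v}. if b then Z i else Y i) p)) *
       h (half v True ((\<lambda>(Y, Z). \<lambda>(b, i)\<in>UNIV \<times> {..<v}. if b then Z i else Y i) p)) =
        (case p of (Y, Z) \<Rightarrow> g Y * h Z)"
      using YZ by simp_all
    show "(\<lambda>(Y, Z). \<lambda>(b, i)\<in>UNIV \<times> {..<v}. if b then Z i else Y i) p \<in> (UNIV \<times> {..<v}) \<rightarrow>\<^sub>E C"
      using YZ by (auto simp: PiE_def extensional_def Pi_def)
  next
    fix X :: "bool \<times> nat \<Rightarrow> point" assume X: "X \<in> (UNIV \<times> {..<v}) \<rightarrow>\<^sub>E C"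
    show "(half v False X, half v True X) \<in> ?P \<times> ?P"
      using X by (auto simp: half_def)
    show "(\<lambda>(Y, Z). \<lambda>(b, i)\<in>UNIV \<times> {..<v}. if b then Z i else Y i) (half v False X, half v True X) = X"
      using X by (auto simp: half_def fun_eq_iff PiE_def extensional_def)
  qed
  finally show ?thesis ..
qed

text \<open>
  \<open>N \<omega>\<close> counts witnesses and \<open>A \<omega>\<close> the accepting ones, so \<open>a \<omega>\<close> is the acceptance ratio.
  As \<open>N\<close> concentrates around \<open>\<mu>\<close>, the mean of \<open>A / N\<close> is close to the mean of \<open>A\<close> over \<open>\<mu>\<close>;
  the parameter \<open>s\<close> comes from \<open>\<bar>t\<bar> \<le> s / 2 + t\<^sup>2 / (2 * s)\<close>.
\<close>

lemma sum_ratio_le: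
  fixes a N A :: "'w \<Rightarrow> real" and \<mu> s :: real
  assumes a: "\<And>w. w \<in> \<Omega> \<Longrightarrow> 0 \<le> a w \<and> a w \<le> 1 \<and> a w * N w = A w"
    and mean: "(\<Sum>w\<in>\<Omega>. N w) = \<mu> * card \<Omega>"
    and second: "(\<Sum>w\<in>\<Omega>. N w ^ 2) \<le> (\<mu> ^ 2 + \<mu>) * card \<Omega>"
    and pos: "\<mu> > 0" "s > 0"
  shows "(\<Sum>w\<in>\<Omega>. a w) \<le> (\<Sum>w\<in>\<Omega>. A w) / \<mu> + (s / 2 + 1 / (2 * s * \<mu>)) * card \<Omega>"
proof -
  have "a w \<le> A w / \<mu> + s / 2 + (1 - N w / \<mu>) ^ 2 / (2 * s)" if "w \<in> \<Omega>" for w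
  proof -
    let ?t = "1 - N w / \<mu>"
    have "0 \<le> (s - \<bar>?t\<bar>) ^ 2" by simp
    then have "2 * s * \<bar>?t\<bar> \<le> s ^ 2 + ?t ^ 2" unfolding power2_diff power2_abs by linarith
    then have "\<bar>?t\<bar> \<le> s / 2 + ?t ^ 2 / (2 * s)"
      using pos by (simp add: field_simps power2_eq_square)
    moreover have "a w * ?t \<le> \<bar>?t\<bar>"
    proof -
      have "a w * ?t \<le> \<bar>a w * ?t\<bar>" by (rule abs_ge_self)
      also have "\<dots> = a w * \<bar>?t\<bar>" using a[OF that] by (simp only: abs_mult abs_of_nonneg)
      also have "\<dots> \<le> \<bar>?t\<bar>" using a[OF that] by (intro mult_left_le_one_le) auto
      finally show ?thesis .
    qed
    \<comment> \<open>This uses only \<open>a w * N w = A w\<close>, so it stays valid where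
      \<open>N w\<close> is 0.\<close>
    moreover have "a w = A w / \<mu> + a w * ?t"
      using a[OF that] pos by (simp add: field_simps)
    ultimately show ?thesis by linarith
  qed
  then have "(\<Sum>w\<in>\<Omega>. a w) \<le> (\<Sum>w\<in>\<Omega>. A w / \<mu> + s / 2 + (1 - N w / \<mu>) ^ 2 / (2 * s))"
    by (rule sum_mono)
  also have "\<dots> = (\<Sum>w\<in>\<Omega>. A w) / \<mu> + s / 2 * card \<Omega> + (\<Sum>w\<in>\<Omega>. (1 - N w / \<mu>) ^ 2) / (2 * s)"
    by (simp add: sum.distrib sum_divide_distrib)
  \<comment> \<open>As in Chebyshev's inequality: the two moment hypotheses bound the variance of
    \<open>N\<close> by \<open>\<mu>\<close>, hence that of \<open>N / \<mu>\<close> by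
    \<open>1 / \<mu>\<close>.\<close>
  also have "(\<Sum>w\<in>\<Omega>. (1 - N w / \<mu>) ^ 2) \<le> card \<Omega> / \<mu>"
  proof -
    have "(\<Sum>w\<in>\<Omega>. (1 - N w / \<mu>) ^ 2) = (\<Sum>w\<in>\<Omega>. 1 - 2 / \<mu> * N w + N w ^ 2 / \<mu> ^ 2)"
      by (intro sum.cong) (simp_all add: power2_diff power_divide)
    also have "\<dots> = card \<Omega> - 2 / \<mu> * (\<Sum>w\<in>\<Omega>. N w) + (\<Sum>w\<in>\<Omega>. N w ^ 2) / \<mu> ^ 2"
      by (simp add: sum.distrib sum_subtractf sum_distrib_left sum_divide_distrib)
    also have "\<dots> \<le> card \<Omega> - 2 / \<mu> * (\<mu> * card \<Omega>) + (\<mu> ^ 2 + \<mu>) * card \<Omega> / \<mu> ^ 2"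
      unfolding mean using second by (intro add_left_mono divide_right_mono) auto
    also have "\<dots> = card \<Omega> / \<mu>"
      using pos by (simp add: field_simps power2_eq_square)
    finally show ?thesis .
  qed
  then have "(\<Sum>w\<in>\<Omega>. (1 - N w / \<mu>) ^ 2) / (2 * s) \<le> card \<Omega> / \<mu> / (2 * s)"
    using pos by (intro divide_right_mono) auto
  finally show ?thesis by (simp add: algebra_simps)
qed

text \<open>The parity indicator is half of 1 plus the product of the signs. The first part counts
  zero-sum families, the second is a sum of powers of Fourier coefficients and is bounded by
  \<open>fourier_far_power_sum\<close>.\<close>

lemma sum_zsum_parity_le:
  assumes far: "far_from \<epsilon> n f (Pol1 n)" and "\<epsilon> < 1 / 2"
    and I: "I \<subseteq> {..<v}" "odd (card I)" "card I \<ge> 2"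
  shows "(\<Sum>Y\<in>{..<v} \<rightarrow>\<^sub>E cube n. of_bool (zsum n I Y) * of_bool ((\<Sum>i\<in>I. f (Y i)) = 0))
    \<le> 2 ^ (n * v) / 2 ^ n * ((1 + (1 - 2 * \<epsilon>) ^ (card I - 2)) / 2)"
proof -
  let ?P = "{..<v} \<rightarrow>\<^sub>E cube n"
  let ?k = "card I"
  have k: "?k \<le> v" using I(1) by (metis card_lessThan card_mono finite_lessThan)
  have ne: "I \<noteq> {}" using I by auto
  have "(\<Sum>Y\<in>?P. of_bool (zsum n I Y) * of_bool ((\<Sum>i\<in>I. f (Y i)) = 0))
      = ((\<Sum>Y\<in>?P. of_bool (zsum n I Y)) + (\<Sum>Y\<in>?P. of_bool (zsum n I Y) * (\<Prod>i\<in>I. sg (f (Y i))))) / 2"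
    by (simp add: of_bool_bit sg_sum sum.distrib[symmetric] sum_divide_distrib algebra_simps del: sum_of_bool_eq sum_of_bool_mult_eq sum_mult_of_bool_eq)
  also have "(\<Sum>Y\<in>?P. of_bool (zsum n I Y)) = (2 ^ (n * v) / 2 ^ n :: real)"
    using sum_zsum[of "{..<v}" I n] I(1) ne by simp
  also have "(\<Sum>Y\<in>?P. of_bool (zsum n I Y) * (\<Prod>i\<in>I. sg (f (Y i))))
      = 2 ^ (n * (v - ?k)) * (\<Sum>S\<in>Pow {..<n}. fourier n (\<lambda>x. sg (f x)) S ^ ?k) / 2 ^ n"
    using sum_zsum_prod[of "{..<v}" I n "\<lambda>x. sg (f x)"] I(1) by simp
  also have "\<dots> \<le> 2 ^ (n * (v - ?k)) * ((1 - 2 * \<epsilon>) ^ (?k - 2) * (2 ^ n) ^ ?k) / 2 ^ n"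
    using fourier_far_power_sum[OF far assms(2) I(2,3)]
    by (intro divide_right_mono mult_left_mono) auto
  also have "2 ^ (n * (v - ?k)) * ((1 - 2 * \<epsilon>) ^ (?k - 2) * (2 ^ n) ^ ?k)
      = 2 ^ (n * v) * (1 - 2 * \<epsilon>) ^ (?k - 2)"
  proof -
    have "n * (v - ?k) + n * ?k = n * v"
      using k by (simp add: add_mult_distrib2[symmetric])
    then have "2 ^ (n * (v - ?k)) * (2 ^ n) ^ ?k = (2 ^ (n * v) :: real)"
      by (metis power_add power_mult)
    then show ?thesis by (simp add: mult_ac)
  qed
  finally show ?thesis by (simp add: field_simps)
qed

text \<open>\<open>sum_ratio_le\<close> for the number of dependencies and of accepting ones. Each
  of the \<open>v choose k\<close> index sets is a dependency with probability
  \<open>1 / 2 ^ n\<close> in either half, whence \<open>\<mu>\<close>; the independent halves turn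
  the bound for one check into its square.\<close>

lemma sum_accept_prob_le:
  fixes s \<epsilon> :: real
  assumes far: "far_from \<epsilon> n f (Pol1 n)" and \<epsilon>: "\<epsilon> < 1 / 2"
    and k: "odd k" "k \<ge> 2" "k \<le> v" and "s > 0"
  defines "\<mu> \<equiv> real (v choose k) / (2 ^ n) ^ 2"
  shows "(\<Sum>X\<in>(UNIV \<times> {..<v}) \<rightarrow>\<^sub>E cube n. accept_prob n k v f X)
    \<le> (((1 + (1 - 2 * \<epsilon>) ^ (k - 2)) / 2) ^ 2 + (s / 2 + 1 / (2 * s * \<mu>)))
      * real (card ((UNIV \<times> {..<v}) \<rightarrow>\<^sub>E cube n :: (bool \<times> nat \<Rightarrow> point) set))"
    (is "(\<Sum>X\<in>?\<Omega>. _) \<le> (?\<tau> ^ 2 + _) * _")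
proof -
  let ?P = "{..<v} \<rightarrow>\<^sub>E cube n"
  let ?K = "{I. I \<subseteq> {..<v} \<and> card I = k}"
  let ?M = "2 ^ (n * v) :: real"
  let ?c = "real (v choose k)"
  let ?q = "2 ^ n :: real"
  define D where "D I Y = (of_bool (zsum n I Y) :: real)" for I :: "nat set" and Y :: "nat \<Rightarrow> point"
  define E where "E I Y = D I Y * of_bool ((\<Sum>i\<in>I. f (Y i)) = 0)" for I and Y :: "nat \<Rightarrow> point"
  have finK: "finite ?K" by (rule finite_subset[of _ "Pow {..<v}"]) auto
  have cardK: "card ?K = v choose k" by (simp add: n_subsets)
  have c_pos: "?c > 0" using k by simp
  have \<mu>_pos: "\<mu> > 0" using c_pos by (simp add: \<mu>_def)
  have card\<Omega>: "real (card ?\<Omega>) = ?M ^ 2"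
    by (subst card_funcsetE) (simp_all add: card_cartesian_product power_mult power2_eq_square UNIV_bool power_add)
  have count: "real (card {I \<in> ?K. p I}) = (\<Sum>I\<in>?K. of_bool (p I))" for p
    using finK by (rule real_card_filter)
  have N: "real (card (dependencies n k v X)) = (\<Sum>I\<in>?K. D I (half v False X) * D I (half v True X))" for X
  proof -
    have "dependencies n k v X = {I \<in> ?K. zsum n I (half v False X) \<and> zsum n I (half v True X)}"
      by (auto simp: dependencies_def)
    then show ?thesis unfolding D_def of_bool_conj[symmetric] by (simp only: count)
  qed
  have A: "real (card {I \<in> dependencies n k v X. run f (parity_checks v X I)})
      = (\<Sum>I\<in>?K. E I (half v False X) * E I (half v True X))" for X
  proof -
    have checks: "run f (parity_checks v X I) \<longleftrightarrow>
        (\<Sum>i\<in>I. f (half v False X i)) = 0 \<and> (\<Sum>i\<in>I. f (half v True X i)) = 0"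
      if "I \<subseteq> {..<v}" for I
      using that finite_subset[of I "{..<v}"] by (intro run_parity_checks) simp
    have "{I \<in> dependencies n k v X. run f (parity_checks v X I)}
        = {I \<in> ?K. (zsum n I (half v False X) \<and> (\<Sum>i\<in>I. f (half v False X i)) = 0)
          \<and> (zsum n I (half v True X) \<and> (\<Sum>i\<in>I. f (half v True X i)) = 0)}"
      unfolding dependencies_def using checks by blast
    then show ?thesis unfolding D_def E_def of_bool_conj[symmetric] by (simp only: count)
  qed
  have D1: "(\<Sum>Y\<in>?P. D I Y) = ?M / ?q" if "I \<in> ?K" for I
  proof -
    have "I \<noteq> {}" using that k by auto
    then show ?thesis unfolding D_def using that sum_zsum[of "{..<v}" I n] by simp
  qed
  have DD: "(\<Sum>Y\<in>?P. D I Y * D J Y) = (if I = J then ?M / ?q else ?M / ?q ^ 2)"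
    if "I \<in> ?K" "J \<in> ?K" for I J
  proof (cases "I = J")
    case True
    have "D I Y * D I Y = D I Y" for Y by (simp add: D_def)
    then show ?thesis using True D1[OF that(1)] by (simp only: refl if_True)
  next
    case False
    then show ?thesis unfolding D_def using that sum_zsum_pair[of "{..<v}" I J n] by auto
  qed
  have mean: "(\<Sum>X\<in>?\<Omega>. real (card (dependencies n k v X))) = \<mu> * card ?\<Omega>"
  proof -
    have "(\<Sum>X\<in>?\<Omega>. real (card (dependencies n k v X))) = (\<Sum>I\<in>?K. (\<Sum>Y\<in>?P. D I Y) * (\<Sum>Y\<in>?P. D I Y))"
      unfolding N by (subst sum.swap) (simp only: sum_two_halves)
    also have "\<dots> = (\<Sum>I\<in>?K. (?M / ?q) * (?M / ?q))"
      using D1 by (intro sum.cong) auto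
    also have "\<dots> = \<mu> * ?M ^ 2"
      by (simp add: cardK \<mu>_def power2_eq_square)
    finally show ?thesis by (simp only: card\<Omega>)
  qed
  have second: "(\<Sum>X\<in>?\<Omega>. real (card (dependencies n k v X)) ^ 2) \<le> (\<mu> ^ 2 + \<mu>) * card ?\<Omega>"
  proof -
    have "(\<Sum>X\<in>?\<Omega>. real (card (dependencies n k v X)) ^ 2)
        = (\<Sum>X\<in>?\<Omega>. \<Sum>I\<in>?K. \<Sum>J\<in>?K. (D I (half v False X) * D J (half v False X)) *
            (D I (half v True X) * D J (half v True X)))"
      unfolding N power2_eq_square sum_product by (simp only: mult_ac)
    also have "\<dots> = (\<Sum>I\<in>?K. \<Sum>J\<in>?K. \<Sum>X\<in>?\<Omega>. (D I (half v False X) * D J (half v False X)) *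
            (D I (half v True X) * D J (half v True X)))"
      by (subst sum.swap, intro sum.cong refl, subst sum.swap) (rule refl)
    also have "\<dots> = (\<Sum>I\<in>?K. \<Sum>J\<in>?K. (\<Sum>Y\<in>?P. D I Y * D J Y) * (\<Sum>Y\<in>?P. D I Y * D J Y))"
      by (intro sum.cong refl sum_two_halves)
    \<comment> \<open>Pairwise independence leaves \<open>\<mu>\<close> from the diagonal and at
      most \<open>\<mu> ^ 2\<close> from the rest; the second summand is granted to
      \<open>J = I\<close> as well, which only enlarges the bound.\<close>
    also have "\<dots> \<le> (\<Sum>I\<in>?K. \<Sum>J\<in>?K. (if J = I then (?M / ?q) ^ 2 else 0) + (?M / ?q ^ 2) ^ 2)"
      by (intro sum_mono) (auto simp: DD power2_eq_square)
    also have "\<dots> = ?c * (?M / ?q) ^ 2 + ?c ^ 2 * (?M / ?q ^ 2) ^ 2"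
      using finK by (simp add: sum.distrib cardK power2_eq_square distrib_left mult.assoc)
    also have "\<dots> = (\<mu> ^ 2 + \<mu>) * ?M ^ 2"
      by (simp add: \<mu>_def power2_eq_square field_simps)
    finally show ?thesis by (simp only: card\<Omega>)
  qed
  have accepting: "(\<Sum>X\<in>?\<Omega>. real (card {I \<in> dependencies n k v X. run f (parity_checks v X I)}))
      \<le> \<mu> * (?\<tau> ^ 2 * card ?\<Omega>)"
  proof -
    have "(\<Sum>X\<in>?\<Omega>. real (card {I \<in> dependencies n k v X. run f (parity_checks v X I)}))
        = (\<Sum>I\<in>?K. (\<Sum>Y\<in>?P. E I Y) ^ 2)"
      unfolding A power2_eq_square by (subst sum.swap) (simp only: sum_two_halves)
    also have "\<dots> \<le> (\<Sum>I\<in>?K. (?M / ?q * ?\<tau>) ^ 2)"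
    proof (intro sum_mono power_mono)
      fix I assume "I \<in> ?K"
      then show "(\<Sum>Y\<in>?P. E I Y) \<le> ?M / ?q * ?\<tau>"
        unfolding E_def D_def using sum_zsum_parity_le[OF far \<epsilon>, of I v] k by auto
      show "0 \<le> (\<Sum>Y\<in>?P. E I Y)" by (intro sum_nonneg) (simp add: E_def D_def)
    qed
    also have "\<dots> = \<mu> * (?\<tau> ^ 2 * ?M ^ 2)"
      by (simp add: cardK \<mu>_def power_divide power_mult_distrib)
    finally show ?thesis by (simp only: card\<Omega>)
  qed
  have "(\<Sum>X\<in>?\<Omega>. accept_prob n k v f X)
      \<le> (\<Sum>X\<in>?\<Omega>. real (card {I \<in> dependencies n k v X. run f (parity_checks v X I)})) / \<mu>
        + (s / 2 + 1 / (2 * s * \<mu>)) * card ?\<Omega>"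
    by (rule sum_ratio_le[OF _ mean second \<mu>_pos \<open>s > 0\<close>])
      (simp add: accept_prob_mult_card, simp add: accept_prob_def pmf_le_1)
  also have "(\<Sum>X\<in>?\<Omega>. real (card {I \<in> dependencies n k v X. run f (parity_checks v X I)})) / \<mu>
      \<le> ?\<tau> ^ 2 * card ?\<Omega>"
    using accepting \<mu>_pos by (simp add: pos_divide_le_eq mult_ac)
  finally show ?thesis by (simp only: distrib_right)
qed

section \<open>From independent points to points of a sample\<close>

definition injections :: "'i set \<Rightarrow> 'a set \<Rightarrow> ('i \<Rightarrow> 'a) set"
  where "injections W C = {X \<in> W \<rightarrow>\<^sub>E C. inj_on X W}"

lemma finite_injections: "finite W \<Longrightarrow> finite C \<Longrightarrow> finite (injections W C)"
  unfolding injections_def by (rule finite_subset[of _ "W \<rightarrow>\<^sub>E C"]) (auto intro: finite_PiE)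

lemma card_injections:
  assumes "finite W" "finite C"
  shows "card (injections W C) = (\<Prod>i<card W. card C - i)"
  using card_inj_on_subset_funcset[OF assms, of W]
  by (simp add: injections_def atLeast0LessThan)

text \<open>Birthday bound: every factor of the falling product is at least
  \<open>card C - card W\<close>, and Bernoulli's inequality bounds the resulting power.\<close>

lemma card_injections_ge:
  assumes "finite W" "finite C" "card W \<le> card C" "C \<noteq> {}"
  shows "(1 - real (card W) ^ 2 / card C) * real (card C) ^ card W \<le> real (card (injections W C))"
proof -
  let ?w = "card W" and ?N = "real (card C)"
  have N: "?N > 0" using assms by (simp add: card_gt_0_iff)
  have "1 + real ?w * (- (real ?w / ?N)) \<le> (1 + - (real ?w / ?N)) ^ ?w"
    using N assms(3) by (intro Bernoulli_inequality) simp
  then have "(1 - real ?w ^ 2 / ?N) * ?N ^ ?w \<le> (1 - real ?w / ?N) ^ ?w * ?N ^ ?w"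
    using N by (intro mult_right_mono) (simp_all add: power2_eq_square)
  also have "\<dots> = (?N - real ?w) ^ ?w"
    using N by (simp add: power_mult_distrib[symmetric] field_simps)
  also have "\<dots> = (\<Prod>i<?w. ?N - real ?w)" by simp
  also have "\<dots> \<le> (\<Prod>i<?w. real (card C - i))"
    using assms(3) by (intro prod_mono) auto
  also have "\<dots> = real (card (injections W C))"
    using assms by (simp add: card_injections)
  finally show ?thesis .
qed

text \<open>Double counting of the pairs of a sample and an injection into it.\<close>

lemma average_injections_samples:
  fixes g :: "('i \<Rightarrow> 'a) \<Rightarrow> real"
  assumes fin: "finite W" "finite C" and u: "card W \<le> u" "u \<le> card C"
  defines "\<U> \<equiv> {U. U \<subseteq> C \<and> card U = u}"
  shows "(\<Sum>U\<in>\<U>. (\<Sum>X\<in>injections W U. g X) / card (injections W U)) / card \<U>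
    = (\<Sum>X\<in>injections W C. g X) / card (injections W C)"
proof -
  let ?b = "real ((card C - card W) choose (u - card W))"
  define c where "c = (\<Prod>i<card W. u - i)"
  have finU: "finite \<U>" unfolding \<U>_def by (rule finite_subset[of _ "Pow C"]) (use fin in auto)
  have c: "card (injections W U) = c" if "U \<in> \<U>" for U
  proof -
    have "finite U" using that fin finite_subset unfolding \<U>_def by blast
    then show ?thesis using that fin by (simp add: card_injections \<U>_def c_def)
  qed
  have dbl: "(\<Sum>U\<in>\<U>. \<Sum>X\<in>injections W U. h X) = ?b * (\<Sum>X\<in>injections W C. h X)"
    for h :: "('i \<Rightarrow> 'a) \<Rightarrow> real"
  proof -
    have "(\<Sum>U\<in>\<U>. \<Sum>X\<in>injections W U. h X) = (\<Sum>U\<in>\<U>. \<Sum>X\<in>{X \<in> injections W C. X ` W \<subseteq> U}. h X)"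
      by (intro sum.cong refl) (auto simp: injections_def \<U>_def PiE_def Pi_def image_subset_iff)
    also have "\<dots> = (\<Sum>X\<in>injections W C. \<Sum>U\<in>{U \<in> \<U>. X ` W \<subseteq> U}. h X)"
      by (rule sum.swap_restrict[OF finU finite_injections[OF fin]])
    also have "\<dots> = (\<Sum>X\<in>injections W C. ?b * h X)"
    proof (intro sum.cong refl)
      fix X assume X: "X \<in> injections W C"
      have "card (X ` W) = card W" "X ` W \<subseteq> C"
        using X by (auto simp: injections_def card_image)
      then have "card {U \<in> \<U>. X ` W \<subseteq> U} = (card C - card W) choose (u - card W)"
        using card_supersets[OF fin(2), of "X ` W" u] u by (simp add: \<U>_def conj_assoc)
      then show "(\<Sum>U\<in>{U \<in> \<U>. X ` W \<subseteq> U}. h X) = ?b * h X" by simp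
    qed
    finally show ?thesis by (simp add: sum_distrib_left)
  qed
  have b_pos: "?b > 0" using u by simp
  have c_pos: "c > 0" unfolding c_def using u by (intro prod_pos) auto
  \<comment> \<open>The double count for the constant function 1 supplies the normalisation.\<close>
  have "real c * card \<U> = (\<Sum>U\<in>\<U>. \<Sum>X\<in>injections W U. 1)"
    using c by simp
  also have "\<dots> = ?b * card (injections W C)"
    unfolding dbl by simp
  finally have one: "real c * card \<U> = ?b * card (injections W C)" .
  have "(\<Sum>U\<in>\<U>. (\<Sum>X\<in>injections W U. g X) / card (injections W U)) / card \<U>
      = (\<Sum>U\<in>\<U>. (\<Sum>X\<in>injections W U. g X)) / (real c * card \<U>)"
    using c by (simp add: sum_divide_distrib[symmetric])
  also have "\<dots> = (\<Sum>X\<in>injections W C. g X) / card (injections W C)"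
    unfolding dbl one using b_pos by simp
  finally show ?thesis .
qed

text \<open>A homogeneous linear function maps points with sum zero to values with sum zero, so
  every check passes.\<close>

lemma accept_prob_linear:
  assumes f: "f \<in> Pol1 n" and X: "X \<in> (UNIV \<times> {..<v}) \<rightarrow>\<^sub>E cube n"
  shows "accept_prob n k v f X = 1"
proof -
  obtain S where S: "S \<subseteq> {..<n}" and f: "f = (\<lambda>x\<in>cube n. \<Sum>i\<in>S. x i)"
    using f unfolding Pol1_def by blast
  have zero: "(\<Sum>i\<in>I. f (half v b X i)) = 0" if I: "I \<subseteq> {..<v}" and z: "zsum n I (half v b X)" for I b
  proof -
    have "(\<Sum>i\<in>I. f (half v b X i)) = (\<Sum>i\<in>I. \<Sum>j\<in>S. half v b X i j)"
      using I X by (intro sum.cong refl) (auto simp: f half_def PiE_def Pi_def)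
    also have "\<dots> = (\<Sum>j\<in>S. \<Sum>i\<in>I. half v b X i j)" by (rule sum.swap)
    also have "\<dots> = 0" using z S by (intro sum.neutral) (auto simp: zsum_def)
    finally show ?thesis .
  qed
  have run: "run f (parity_checks v X I)" if "I \<in> dependencies n k v X" for I
  proof -
    have "finite I" using that finite_subset by (auto simp: dependencies_def)
    then show ?thesis using that zero by (simp add: run_parity_checks dependencies_def)
  qed
  show ?thesis
  proof (cases "dependencies n k v X = {}")
    case True
    then show ?thesis by (simp add: accept_prob_def dependency_test_def)
  next
    case False
    have "{I \<in> dependencies n k v X. run f (parity_checks v X I)} = dependencies n k v X"
      using run by auto
    then have "accept_prob n k v f X * real (card (dependencies n k v X)) = card (dependencies n k v X)"
      by (simp only: accept_prob_mult_card)
    then show ?thesis using False by simp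
  qed
qed

text \<open>The tester places the \<open>2 * v\<close> indices in \<open>U\<close> by a uniform
  injection. Averaged over \<open>U\<close>, this is a uniform injection into the cube, and by
  \<open>birthday\<close> injections are so frequent that the bound for independent points loses
  only a factor \<open>20 / 19\<close>.\<close>

lemma tester_exists:
  assumes \<epsilon>: "\<epsilon> < 1 / 2"
    and k: "odd k" "k \<ge> 2" "k \<le> v" and v: "2 * v \<le> u" and u: "u \<le> 2 ^ n"
    and many: "400 * (2 ^ n) ^ 2 \<le> real (v choose k)"
    and bias: "(1 - 2 * \<epsilon>) ^ (k - 2) \<le> 1 / 100"
    and birthday: "20 * real (2 * v) ^ 2 \<le> 2 ^ n"
  shows "\<exists>A. tester \<epsilon> n (Pol1 n) u (2 * k) A"
proof -
  let ?W = "UNIV \<times> {..<v} :: (bool \<times> nat) set"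
  define A where "A U = bind_pmf (pmf_of_set (injections ?W U)) (dependency_test n k v)" for U
  have cardW: "card ?W = 2 * v" by (simp add: card_cartesian_product UNIV_bool)
  have finW: "finite ?W" by simp
  have inj_ne: "injections ?W U \<noteq> {}" and inj_fin: "finite (injections ?W U)"
    if U: "U \<in> samples n u" for U
  proof -
    have finU: "finite U" "card U = u"
      using U finite_subset[OF _ finite_cube] by (auto simp: samples_def)
    then show "finite (injections ?W U)" using finW by (intro finite_injections)
    have "card (injections ?W U) > 0"
      unfolding card_injections[OF finW finU(1)] cardW finU(2) using v by (intro prod_pos) auto
    then show "injections ?W U \<noteq> {}" by auto
  qed
  have ne: "samples n u \<noteq> {}"
    using u card_samples[of n u] by (metis card.empty not_less zero_less_binomial less_irrefl)
  let ?J = "injections ?W (cube n)"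
  have out: "pmf (outcome n u A f) True = (\<Sum>X\<in>?J. accept_prob n k v f X) / card ?J" for f
  proof -
    have "pmf (outcome n u A f) True
        = (\<Sum>U\<in>samples n u. pmf (map_pmf (run f) (A U)) True) / card (samples n u)"
      unfolding outcome_def using ne by (simp add: pmf_bind_pmf_of_set)
    also have "(\<Sum>U\<in>samples n u. pmf (map_pmf (run f) (A U)) True)
        = (\<Sum>U\<in>samples n u. (\<Sum>X\<in>injections ?W U. accept_prob n k v f X) / card (injections ?W U))"
      using inj_ne inj_fin
      by (intro sum.cong refl) (simp add: A_def map_bind_pmf pmf_bind_pmf_of_set accept_prob_def)
    finally show ?thesis
      using average_injections_samples[OF finW finite_cube[of n], of u "accept_prob n k v f"] v u
      unfolding cardW samples_def by simp
  qed
  have J_le: "(1 - 1 / 20) * real (card (?W \<rightarrow>\<^sub>E cube n)) \<le> real (card ?J)"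
  proof -
    have "(1 - 1 / 20) * real (card (?W \<rightarrow>\<^sub>E cube n)) = (1 - 1 / 20) * real (2 ^ n) ^ card ?W"
      by (subst card_funcsetE) simp_all
    also have "\<dots> \<le> (1 - real (card ?W) ^ 2 / card (cube n)) * real (card (cube n)) ^ card ?W"
    proof (intro mult_mono)
      have "20 * real (card ?W) ^ 2 \<le> 2 ^ n" using birthday unfolding cardW .
      then have "real (card ?W) ^ 2 / card (cube n) \<le> 1 / 20"
        by (simp add: pos_divide_le_eq del: card_cartesian_product)
      then show "1 - 1 / 20 \<le> 1 - real (card ?W) ^ 2 / card (cube n)"
        and "0 \<le> 1 - real (card ?W) ^ 2 / card (cube n)"
        by linarith+
    qed simp_all
    also have "\<dots> \<le> real (card ?J)"
      using v u by (intro card_injections_ge) (auto simp: cardW simp del: card_cartesian_product)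
    finally show ?thesis .
  qed
  have card_pos: "real (card (?W \<rightarrow>\<^sub>E cube n)) > 0"
    by (subst card_funcsetE) simp_all
  have J_pos: "real (card ?J) > 0"
    by (rule less_le_trans[OF _ J_le]) (intro mult_pos_pos card_pos, simp)
  have complete: "pmf (outcome n u A f) True \<ge> 2 / 3" if "f \<in> Pol1 n" for f
  proof -
    have "(\<Sum>X\<in>?J. accept_prob n k v f X) = (\<Sum>X\<in>?J. 1)"
      using that by (intro sum.cong refl accept_prob_linear) (auto simp: injections_def)
    then show ?thesis unfolding out using J_pos by simp
  qed
  have sound: "pmf (outcome n u A f) False \<ge> 2 / 3" if far: "far_from \<epsilon> n f (Pol1 n)" for f
  proof -
    let ?\<Omega> = "?W \<rightarrow>\<^sub>E cube n"
    let ?\<mu> = "real (v choose k) / (2 ^ n) ^ 2"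
    let ?\<beta> = "(1 - 2 * \<epsilon>) ^ (k - 2)"
    have "400 \<le> ?\<mu>" using many by (simp add: pos_le_divide_eq)
    then have \<mu>: "1 / (2 * (1 / 20) * ?\<mu>) \<le> 1 / 40"
      using frac_le[of 1 1 40 "2 * (1 / 20) * ?\<mu>"] by simp
    have "0 \<le> ?\<beta>" using \<epsilon> by simp
    then have "((1 + ?\<beta>) / 2) ^ 2 \<le> (101 / 200) ^ 2"
      using bias by (intro power_mono) auto
    then have sq: "((1 + ?\<beta>) / 2) ^ 2 \<le> 10201 / 40000" by (simp add: power2_eq_square)
    \<comment> \<open>Probabilities are nonnegative, so the sum may be extended to families with
      repetitions, whose points are independent.\<close>
    have "(\<Sum>X\<in>?J. accept_prob n k v f X) \<le> (\<Sum>X\<in>?\<Omega>. accept_prob n k v f X)"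
      by (intro sum_mono2 finite_PiE) (auto simp: injections_def accept_prob_def)
    \<comment> \<open>With \<open>s = 1 / 20\<close> and \<open>?\<mu>\<close> at least 400, each of
      the two error terms is at most \<open>1 / 40\<close>.\<close>
    also have "\<dots> \<le> (((1 + ?\<beta>) / 2) ^ 2 + (1 / 20 / 2 + 1 / (2 * (1 / 20) * ?\<mu>))) * card ?\<Omega>"
      by (rule sum_accept_prob_le[OF far \<epsilon> k]) simp
    \<comment> \<open>Here \<open>19 / 60\<close> is \<open>1 / 3\<close> times the fraction
      \<open>19 / 20\<close> from \<open>J_le\<close>, and \<open>10201 / 40000 + 1 / 20\<close>
      lies below it.\<close>
    also have "\<dots> \<le> (19 / 60) * card ?\<Omega>"
      using \<mu> sq by (intro mult_right_mono) auto
    also have "\<dots> \<le> 1 / 3 * card ?J"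
      using J_le by simp
    finally have "pmf (outcome n u A f) True \<le> 1 / 3"
      unfolding out using J_pos by (simp add: pos_divide_le_eq)
    then show ?thesis by (simp add: pmf_bool_False)
  qed
  have trees: "queries t \<subseteq> U \<and> depth t \<le> 2 * k" if U: "U \<in> samples n u" and t: "t \<in> set_pmf (A U)" for U t
  proof -
    obtain X where X: "X \<in> injections ?W U" and t: "t \<in> set_pmf (dependency_test n k v X)"
      using t inj_ne[OF U] inj_fin[OF U] by (auto simp: A_def)
    have "X ` ?W \<subseteq> U" using X by (auto simp: injections_def)
    then show ?thesis using dependency_test_trees[OF t] by blast
  qed
  show ?thesis
    unfolding tester_def using complete sound trees by blast
qed

section \<open>Asymptotics\<close>

text \<open>For smaller \<open>q\<close> one has \<open>u ^ q\<close> at most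
  \<open>2 powr (n / 2)\<close> and \<open>q\<close> at most \<open>n\<close>, so the bound of
  \<open>tester_lower_bound\<close> would fall below \<open>1 / 3\<close>.\<close>

lemma eventually_query_lower_bound:
  assumes "\<epsilon> < 1 / 2"
  shows "\<forall>\<^sub>F n in at_top. \<forall>u q A. n ^ 2 \<le> u \<and> u \<le> 2 ^ n \<and> tester \<epsilon> n (Pol1 n) u q A \<longrightarrow>
    1 / 2 * (real n / log 2 (real u)) \<le> real q"
proof -
  have "\<forall>\<^sub>F n in at_top. real n * 2 powr (- real n / 2) < 1 / 3"
    by real_asymp
  then show ?thesis
    using eventually_ge_at_top[of 2]
  proof eventually_elim
    case (elim n)
    show ?case
    proof (intro allI impI, elim conjE)
      fix u q A
      assume u: "n ^ 2 \<le> u" "u \<le> 2 ^ n" and tester: "tester \<epsilon> n (Pol1 n) u q A"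
      have "2 ^ 2 \<le> n ^ 2" using elim by (intro power_mono) auto
      then have "4 \<le> u" using u by simp
      then have L: "1 \<le> log 2 u" by simp
      show "1 / 2 * (real n / log 2 (real u)) \<le> real q"
      proof (rule ccontr)
        assume "\<not> ?thesis"
        then have "real q < real n / 2 / log 2 u" by simp
        then have qL: "real q * log 2 u < real n / 2" using L by (simp add: pos_less_divide_eq)
        moreover have "real q * 1 \<le> real q * log 2 u" using L by (intro mult_left_mono) auto
        ultimately have "real q \<le> real n" by linarith
        have "real u ^ q = 2 powr (real q * log 2 u)"
          using \<open>4 \<le> u\<close> by (simp add: powr_realpow[symmetric] powr_powr[symmetric] mult.commute[of "real q"])
        also have "\<dots> \<le> 2 powr (real n / 2)" using qL by simp
        finally have "real q * real u ^ q / 2 ^ n \<le> real n * 2 powr (real n / 2) / 2 ^ n"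
          using \<open>real q \<le> real n\<close> by (intro divide_right_mono mult_mono) auto
        also have "\<dots> = real n * (2 powr (real n / 2) / 2 powr real n)"
          by (simp add: powr_realpow)
        also have "\<dots> = real n * 2 powr (- real n / 2)"
          by (simp only: powr_diff[symmetric]) (simp add: field_simps)
        also have "\<dots> < 1 / 3" by fact
        finally show False
          using tester_lower_bound[OF assms u(2) _ tester] \<open>4 \<le> u\<close> by simp
      qed
    qed
  qed
qed

section \<open>Choice of the parameters of the test\<close>

text \<open>The binomial is at least \<open>(v / k) ^ k\<close>, and \<open>k ^ 2 \<le> v\<close>
  makes \<open>v / k\<close> at least the square root of \<open>v\<close>, so it is at least
  \<open>2 ^ (3 * n)\<close>. One factor \<open>2 ^ n\<close>, at least 512, pays for the 400.
  Squares are compared to avoid the root.\<close>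

lemma many_subsets:
  assumes k: "0 < k" "k ^ 2 \<le> v" and v: "2 powr (6 * real n / real k) \<le> real v" and n: "9 \<le> n"
  shows "400 * (2 ^ n) ^ 2 \<le> real (v choose k)"
proof -
  have "k \<le> k ^ 2" by (simp add: power2_eq_square)
  then have kv: "k \<le> v" using k by linarith
  have "real v \<le> (real v / real k) ^ 2"
  proof -
    have "real v * real k ^ 2 \<le> real v * real v"
      using k(2) by (intro mult_left_mono) (simp_all flip: of_nat_power)
    then show ?thesis using k(1) by (simp add: power_divide pos_le_divide_eq power2_eq_square)
  qed
  then have "2 powr (6 * real n / real k) \<le> (real v / real k) ^ 2" using v by linarith
  then have "(2 powr (6 * real n / real k)) ^ k \<le> ((real v / real k) ^ 2) ^ k"
    by (intro power_mono) auto
  also have "(2 powr (6 * real n / real k)) ^ k = 2 powr (6 * real n)"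
    using k(1) by (simp add: powr_realpow[symmetric] powr_powr)
  also have "\<dots> = ((2 ^ n) ^ 3) ^ 2"
    by (simp add: powr_realpow[symmetric] powr_powr)
  also have "((real v / real k) ^ 2) ^ k = ((real v / real k) ^ k) ^ 2"
    by (simp add: power_mult[symmetric] mult.commute)
  finally have "(2 ^ n) ^ 3 \<le> (real v / real k) ^ k"
    by (rule power2_le_imp_le) simp
  also have "\<dots> \<le> real (v choose k)"
    using binomial_ge_n_over_k_pow_k[OF kv, where 'a = real] by simp
  finally have "(2 ^ n) ^ 3 \<le> real (v choose k)" .
  moreover have "400 * (2 ^ n) ^ 2 \<le> (2 ^ n :: real) ^ 3"
  proof -
    have "(2::real) ^ 9 \<le> 2 ^ n" using n by (intro power_increasing) auto
    then have "400 * (2 ^ n) ^ 2 \<le> 2 ^ n * (2 ^ n :: real) ^ 2" by (intro mult_right_mono) auto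
    then show ?thesis by (simp add: power3_eq_cube power2_eq_square)
  qed
  ultimately show ?thesis by linarith
qed

lemma eventually_tester_exists:
  assumes \<epsilon>: "0 < \<epsilon>" "\<epsilon> < 1 / 2"
  obtains c :: real where "c > 0"
    "\<forall>\<^sub>F n in at_top. \<forall>u. n ^ 2 \<le> u \<and> u \<le> 2 ^ n \<longrightarrow>
      (\<exists>q A. tester \<epsilon> n (Pol1 n) u q A \<and> real q \<le> c * (real n / log 2 (real u)))"
proof -
  obtain m where m: "(1 - 2 * \<epsilon>) ^ m < 1 / 100"
    using real_arch_pow_inv[of "1 / 100" "1 - 2 * \<epsilon>"] \<epsilon> by auto
  \<comment> \<open>As \<open>L\<close> is at least \<open>2 * log 2 n\<close>, the term
    \<open>30 * n / L\<close> in the bound on \<open>k\<close> becomes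
    \<open>15 * n / log 2 n\<close>; thus \<open>k\<close> is at most \<open>n / 2\<close> and
    \<open>k ^ 2\<close> at most \<open>n ^ 2 / 4\<close>, hence at most \<open>v\<close>.\<close>
  have "\<forall>\<^sub>F n in at_top. 2 * real m + 5 + 15 * (real n / log 2 (real n)) \<le> real n / 2"
    by real_asymp
  moreover have "\<forall>\<^sub>F n in at_top. real n ^ 2 / 4 \<le> 2 powr (real n / 5)"
    by real_asymp
  ultimately have "\<forall>\<^sub>F n in at_top. \<forall>u. n ^ 2 \<le> u \<and> u \<le> 2 ^ n \<longrightarrow>
      (\<exists>q A. tester \<epsilon> n (Pol1 n) u q A \<and> real q \<le> (4 * real m + 70) * (real n / log 2 (real u)))"
    using eventually_ge_at_top[of 20]
  proof eventually_elim
    case (elim n)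
    show ?case
    proof (intro allI impI, elim conjE)
      fix u assume u: "n ^ 2 \<le> u" "u \<le> 2 ^ n"
      define L where "L = log 2 (real u)"
      \<comment> \<open>The summand 3 makes \<open>k\<close> odd, \<open>m\<close> takes care of the
        bias, and \<open>k\<close> being at least \<open>30 * n / L\<close> yields
        \<open>6 * n / k \<le> L / 5\<close>, as required by \<open>many_subsets\<close>.\<close>
      define k where "k = 2 * (m + nat \<lceil>15 * real n / L\<rceil>) + 3"
      \<comment> \<open>The first bound lets both halves fit into the sample, the second meets the
        birthday condition; still \<open>v\<close> is at least
        \<open>2 powr (L / 5)\<close>.\<close>
      define v where "v = min (u div 2) (2 ^ (n div 4))"
      have "20 ^ 2 \<le> n ^ 2" using elim by (intro power_mono) auto
      then have u400: "400 \<le> u" using u by simp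
      have "log 2 (real n ^ 2) \<le> L"
        unfolding L_def using u u400 elim by (subst log_le_cancel_iff) (simp_all flip: of_nat_power)
      then have L_ge: "2 * log 2 n \<le> L" using elim by (simp add: log_nat_power)
      have "log 2 16 \<le> log 2 (real n)" using elim by (subst log_le_cancel_iff) auto
      moreover have "log 2 16 = (4::real)" using log_pow_cancel[of 2 4] by simp
      ultimately have log4: "4 \<le> log 2 (real n)" by simp
      then have L8: "8 \<le> L" using L_ge by linarith
      have u_powr: "real u = 2 powr L" using u400 by (simp add: L_def)
      have "real u \<le> real (2 ^ n)" using u(2) by (simp only: of_nat_le_iff)
      then have "2 powr L \<le> 2 powr real n" by (simp add: u_powr powr_realpow)
      then have Ln: "L \<le> n" by simp
      have k_le: "real k \<le> 2 * real m + 5 + 30 * (real n / L)"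
      proof -
        have "0 \<le> 15 * real n / L" using L8 by simp
        then have "real (nat \<lceil>15 * real n / L\<rceil>) \<le> 15 * real n / L + 1" by linarith
        then show ?thesis by (simp add: k_def)
      qed
      have k_ge: "30 * (real n / L) \<le> real k"
      proof -
        have "15 * real n / L \<le> real (nat \<lceil>15 * real n / L\<rceil>)" by linarith
        then show ?thesis by (simp add: k_def)
      qed
      have "30 * (real n / L) \<le> 30 * (real n / (2 * log 2 n))"
        using L_ge log4 by (intro mult_left_mono divide_left_mono) auto
      then have k_half: "real k \<le> real n / 2" using k_le elim by simp
      have v_ge: "2 powr (L / 5) \<le> real v \<and> real n ^ 2 / 4 \<le> real v"
      proof (cases "u div 2 \<le> 2 ^ (n div 4)")
        case True
        then have v: "real v \<ge> real u / 4" unfolding v_def using u400 by simp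
        have "2 powr (L / 5) \<le> 2 powr (L - 2)" using L8 by simp
        also have "\<dots> = real u / 4" by (simp add: powr_diff u_powr)
        finally have "2 powr (L / 5) \<le> real u / 4" .
        moreover have "real n ^ 2 \<le> real u"
          using of_nat_mono[OF u(1), where 'a = real] by (simp only: of_nat_power)
        ultimately show ?thesis using v by linarith
      next
        case False
        then have "real v = 2 powr real (n div 4)" by (simp add: v_def powr_realpow)
        moreover have "real n / 5 \<le> real (n div 4)" using elim by linarith
        ultimately have "2 powr (real n / 5) \<le> real v" by simp
        moreover have "2 powr (L / 5) \<le> 2 powr (real n / 5)" using Ln by simp
        ultimately show ?thesis using elim by linarith
      qed
      have "real k ^ 2 \<le> (real n / 2) ^ 2" using k_half by (intro power_mono) auto
      then have "real k ^ 2 \<le> real n ^ 2 / 4" by (simp add: power_divide)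
      then have "real k ^ 2 \<le> real v" using v_ge by linarith
      then have kv2: "k ^ 2 \<le> v" by (simp only: of_nat_power[symmetric] of_nat_le_iff)
      have "k \<le> k ^ 2" by (simp add: power2_eq_square)
      then have kv: "k \<le> v" using kv2 by linarith
      have k_pos: "0 < k" "2 \<le> k" "odd k" by (simp_all add: k_def)
      have "6 * real n / real k \<le> L / 5"
        using k_ge k_pos L8 by (simp add: field_simps)
      then have "2 powr (6 * real n / real k) \<le> real v"
        using v_ge by (meson order_trans powr_le_cancel_iff one_less_numeral_iff semiring_norm(76))
      then have many: "400 * (2 ^ n) ^ 2 \<le> real (v choose k)"
        using many_subsets k_pos(1) kv2 elim by simp
      have "(1 - 2 * \<epsilon>) ^ (k - 2) \<le> (1 - 2 * \<epsilon>) ^ m"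
        using \<epsilon> by (intro power_decreasing) (auto simp: k_def)
      then have bias: "(1 - 2 * \<epsilon>) ^ (k - 2) \<le> 1 / 100" using m by linarith
      have "20 * real (2 * v) ^ 2 \<le> 2 ^ 7 * (2 ^ (n div 4)) ^ 2"
      proof -
        have "real v \<le> 2 ^ (n div 4)"
          unfolding v_def by (simp add: min_le_iff_disj)
        then have "real v ^ 2 \<le> (2 ^ (n div 4)) ^ 2" by (intro power_mono) auto
        then have "80 * real v ^ 2 \<le> 2 ^ 7 * (2 ^ (n div 4)) ^ 2" by (intro mult_mono) auto
        moreover have "20 * real (2 * v) ^ 2 = 80 * real v ^ 2" by (simp add: power_mult_distrib)
        ultimately show ?thesis by (simp only:)
      qed
      also have "\<dots> = 2 ^ (7 + n div 4 * 2)" by (simp add: power_add power_mult)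
      also have "\<dots> \<le> (2::real) ^ n" using elim by (intro power_increasing) auto
      finally have birthday: "20 * real (2 * v) ^ 2 \<le> 2 ^ n" .
      have "\<exists>A. tester \<epsilon> n (Pol1 n) u (2 * k) A"
        by (rule tester_exists[OF \<epsilon>(2) k_pos(3,2) kv _ u(2) many bias birthday]) (simp add: v_def)
      \<comment> \<open>The constant \<open>4 * m + 10\<close> is absorbed because
        \<open>L \<le> n\<close> gives \<open>n / L\<close> at least 1.\<close>
      moreover have "real (2 * k) \<le> (4 * real m + 70) * (real n / L)"
      proof -
        define r where "r = real n / L"
        have "1 \<le> r" unfolding r_def using Ln L8 by (simp add: pos_le_divide_eq)
        then have "(4 * real m + 10) * 1 \<le> (4 * real m + 10) * r"
          by (intro mult_left_mono) auto
        then have "real (2 * k) \<le> (4 * real m + 70) * r"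
          using k_le[folded r_def] by (simp add: algebra_simps)
        then show ?thesis unfolding r_def .
      qed
      ultimately show "\<exists>q A. tester \<epsilon> n (Pol1 n) u q A \<and>
          real q \<le> (4 * real m + 70) * (real n / log 2 (real u))"
        unfolding L_def by blast
    qed
  qed
  then show ?thesis by (intro that[of "4 * real m + 70"]) auto
qed

section \<open>Matching bounds for the query complexity\<close>

lemma active_query_complexity_bounds:
  assumes \<epsilon>: "0 < \<epsilon>" "\<epsilon> < 1 / 2"
  obtains c1 c2 :: real where "c1 > 0" "c2 > 0"
    "\<forall>\<^sub>F n in at_top. \<forall>u. n ^ 2 \<le> u \<and> u \<le> 2 ^ n \<longrightarrow>
      active_query_complexity \<epsilon> n (Pol1 n) u \<noteq> \<infinity> \<and>
      c1 * (real n / log 2 (real u)) \<le> real (the_enat (active_query_complexity \<epsilon> n (Pol1 n) u)) \<and>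
      real (the_enat (active_query_complexity \<epsilon> n (Pol1 n) u)) \<le> c2 * (real n / log 2 (real u))"
proof -
  obtain c :: real where c: "c > 0" and upper: "\<forall>\<^sub>F n in at_top. \<forall>u. n ^ 2 \<le> u \<and> u \<le> 2 ^ n \<longrightarrow>
      (\<exists>q A. tester \<epsilon> n (Pol1 n) u q A \<and> real q \<le> c * (real n / log 2 (real u)))"
    using eventually_tester_exists[OF \<epsilon>] .
  have "\<forall>\<^sub>F n in at_top. \<forall>u. n ^ 2 \<le> u \<and> u \<le> 2 ^ n \<longrightarrow>
      active_query_complexity \<epsilon> n (Pol1 n) u \<noteq> \<infinity> \<and>
      1 / 2 * (real n / log 2 (real u)) \<le> real (the_enat (active_query_complexity \<epsilon> n (Pol1 n) u)) \<and>
      real (the_enat (active_query_complexity \<epsilon> n (Pol1 n) u)) \<le> c * (real n / log 2 (real u))"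
    using upper eventually_query_lower_bound[OF \<epsilon>(2)]
  proof eventually_elim
    case (elim n)
    show ?case
    proof (intro allI impI)
      fix u assume u: "n ^ 2 \<le> u \<and> u \<le> 2 ^ n"
      let ?S = "{enat q | q. \<exists>A. tester \<epsilon> n (Pol1 n) u q A}"
      let ?Q = "active_query_complexity \<epsilon> n (Pol1 n) u"
      obtain q A where q: "tester \<epsilon> n (Pol1 n) u q A" "real q \<le> c * (real n / log 2 (real u))"
        using elim(1) u by blast
      then have mem: "enat q \<in> ?S" by blast
      \<comment> \<open>The infimum is attained by well-ordering, so the lower bound for testers
        applies to the minimum itself.\<close>
      then have "Inf ?S \<in> ?S" by (intro wellorder_InfI)
      then obtain p B where p: "?Q = enat p" "tester \<epsilon> n (Pol1 n) u p B"
        unfolding active_query_complexity_def by blast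
      have "?Q \<le> enat q" unfolding active_query_complexity_def using mem by (rule Inf_lower)
      then have "p \<le> q" using p by simp
      then have "real p \<le> c * (real n / log 2 (real u))" using q(2) by linarith
      moreover have "1 / 2 * (real n / log 2 (real u)) \<le> real p" using elim(2) u p by blast
      ultimately show "?Q \<noteq> \<infinity> \<and> 1 / 2 * (real n / log 2 (real u)) \<le> real (the_enat ?Q)
          \<and> real (the_enat ?Q) \<le> c * (real n / log 2 (real u))"
        using p by simp
    qed
  qed
  then show ?thesis using c by (intro that[of "1 / 2" c]) auto
qed

theorem theorem11:
  fixes \<epsilon> :: real
  assumes "0 < \<epsilon>" and "\<epsilon> < 1 / 2"
  shows "enat_bigtheta large_samples
           (\<lambda>(n, u). active_query_complexity \<epsilon> n (Pol1 n) u)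
           (\<lambda>(n, u). real n / log 2 (real u))
       \<and> (\<forall>(u :: nat \<Rightarrow> nat) (k :: nat).
           (\<forall>\<^sub>F n in at_top. n ^ 2 \<le> u n) \<and> (\<lambda>n. real (u n)) \<in> O(\<lambda>n. real n ^ k) \<longrightarrow>
           enat_bigtheta at_top
             (\<lambda>n. active_query_complexity \<epsilon> n (Pol1 n) (u n))
             (\<lambda>n. real n / log 2 (real n)))"
proof -
  let ?Q = "\<lambda>n u. active_query_complexity \<epsilon> n (Pol1 n) u"
  obtain c1 c2 :: real where c: "c1 > 0" "c2 > 0"
    and bounds: "\<forall>\<^sub>F n in at_top. \<forall>u. n ^ 2 \<le> u \<and> u \<le> 2 ^ n \<longrightarrow> ?Q n u \<noteq> \<infinity> \<and>
      c1 * (real n / log 2 (real u)) \<le> real (the_enat (?Q n u)) \<and>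
      real (the_enat (?Q n u)) \<le> c2 * (real n / log 2 (real u))"
    using active_query_complexity_bounds[OF assms] .
  show ?thesis
  proof (intro conjI allI impI, goal_cases)
    case 1
    obtain N where N: "?Q n u \<noteq> \<infinity> \<and>
      c1 * (real n / log 2 (real u)) \<le> real (the_enat (?Q n u)) \<and>
      real (the_enat (?Q n u)) \<le> c2 * (real n / log 2 (real u))"
      if "n \<ge> N" "n ^ 2 \<le> u" "u \<le> 2 ^ n" for n u
      using bounds unfolding eventually_at_top_linorder by blast
    \<comment> \<open>For \<open>u\<close> at most 1 the quotient is 0, by the default values of
      \<open>ln\<close> at 0 and of division by 0.\<close>
    have abs: "norm (real n / log 2 (real u)) = real n / log 2 (real u)" for n u :: nat
      by (cases "u = 0") (simp_all add: log_def)
    show ?case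
      unfolding enat_bigtheta_def
    proof (intro conjI bigthetaI'[OF c])
      show "\<forall>\<^sub>F x in large_samples. (case x of (n, u) \<Rightarrow> ?Q n u) \<noteq> \<infinity>"
        unfolding eventually_large_samples prod.case using N by blast
      show "\<forall>\<^sub>F x in large_samples.
          c1 * norm (case x of (n, u) \<Rightarrow> real n / log 2 (real u))
            \<le> norm (real (the_enat (case x of (n, u) \<Rightarrow> ?Q n u))) \<and>
          norm (real (the_enat (case x of (n, u) \<Rightarrow> ?Q n u)))
            \<le> c2 * norm (case x of (n, u) \<Rightarrow> real n / log 2 (real u))"
        unfolding eventually_large_samples prod.case abs norm_of_nat using N by blast
    qed
  next
    case (2 u k)
    then have u_ge: "\<forall>\<^sub>F n in at_top. n ^ 2 \<le> u n" and u_O: "(\<lambda>n. real (u n)) \<in> O(\<lambda>n. real n ^ k)"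
      by blast+
    obtain C where C: "C > 0" "\<forall>\<^sub>F n in at_top. norm (real (u n)) \<le> C * norm (real n ^ k)"
      using landau_o.bigE[OF u_O] .
    \<comment> \<open>Polynomial growth eventually puts \<open>u n\<close> into the range below
      \<open>2 ^ n\<close> where the uniform bounds hold.\<close>
    have "\<forall>\<^sub>F n in at_top. C * real n ^ k < 2 ^ n"
      by real_asymp
    \<comment> \<open>Once \<open>n\<close> is at least \<open>C\<close>, \<open>u n\<close> lies
      between \<open>n\<close> and \<open>n ^ (k + 1)\<close>; so \<open>log 2 (u n)\<close> exceeds
      \<open>log 2 n\<close> by a factor of at most \<open>k + 1\<close>, which divides
      \<open>c1\<close>.\<close>
    then have main: "\<forall>\<^sub>F n in at_top. ?Q n (u n) \<noteq> \<infinity> \<and>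
      c1 / real (k + 1) * (real n / log 2 (real n)) \<le> real (the_enat (?Q n (u n))) \<and>
      real (the_enat (?Q n (u n))) \<le> c2 * (real n / log 2 (real n))"
      using u_ge C(2) bounds eventually_ge_at_top[of "nat \<lceil>C\<rceil>"] eventually_ge_at_top[of 2]
    proof eventually_elim
      case (elim n)
      have u_le: "real (u n) \<le> C * real n ^ k" using elim(3) by simp
      then have "real (u n) \<le> real (2 ^ n)"
        using elim(1) unfolding of_nat_power of_nat_numeral by linarith
      then have "u n \<le> 2 ^ n" by (simp only: of_nat_le_iff)
      then have b: "?Q n (u n) \<noteq> \<infinity> \<and>
        c1 * (real n / log 2 (real (u n))) \<le> real (the_enat (?Q n (u n))) \<and>
        real (the_enat (?Q n (u n))) \<le> c2 * (real n / log 2 (real (u n)))"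
        using elim(2,4) by blast
      have "n \<le> n ^ 2" by (simp add: power2_eq_square)
      then have "real n \<le> real (u n)" using elim(2) by linarith
      then have lower: "log 2 (real n) \<le> log 2 (real (u n))"
        using elim(6) by (subst log_le_cancel_iff) auto
      have "C \<le> real n" using elim(5) by linarith
      then have "C * real n ^ k \<le> real n ^ (k + 1)" by (simp add: mult_right_mono)
      then have "real (u n) \<le> real n ^ (k + 1)" using u_le by linarith
      then have "log 2 (real (u n)) \<le> log 2 (real n ^ (k + 1))"
        using elim(6) \<open>real n \<le> real (u n)\<close> by (subst log_le_cancel_iff) auto
      then have upper: "log 2 (real (u n)) \<le> real (k + 1) * log 2 (real n)"
        using elim(6) by (subst (asm) log_nat_power) auto
      have pos: "log 2 (real n) > 0" using elim(6) by simp
      have "c1 / real (k + 1) * (real n / log 2 (real n)) = c1 * (real n / (real (k + 1) * log 2 (real n)))"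
        by (simp add: field_simps)
      also have "\<dots> \<le> c1 * (real n / log 2 (real (u n)))"
        using upper lower pos c by (intro mult_left_mono divide_left_mono mult_pos_pos) auto
      finally have "c1 / real (k + 1) * (real n / log 2 (real n)) \<le> real (the_enat (?Q n (u n)))"
        using b by linarith
      moreover have "c2 * (real n / log 2 (real (u n))) \<le> c2 * (real n / log 2 (real n))"
        using lower pos c by (intro mult_left_mono divide_left_mono mult_pos_pos) auto
      ultimately show ?case using b by linarith
    qed
    have abs: "norm (real n / log 2 (real n)) = real n / log 2 (real n)" for n :: nat
      by (cases "n = 0") (simp_all add: log_def)
    have "(\<lambda>n. real (the_enat (?Q n (u n)))) \<in> \<Theta>(\<lambda>n. real n / log 2 (real n))"
    proof (rule bigthetaI'[of "c1 / real (k + 1)" c2])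
      show "\<forall>\<^sub>F n in at_top.
          c1 / real (k + 1) * norm (real n / log 2 (real n)) \<le> norm (real (the_enat (?Q n (u n)))) \<and>
          norm (real (the_enat (?Q n (u n)))) \<le> c2 * norm (real n / log 2 (real n))"
        using main unfolding abs norm_of_nat by eventually_elim blast
    qed (use c in simp_all)
    moreover have "\<forall>\<^sub>F n in at_top. ?Q n (u n) \<noteq> \<infinity>"
      using main by eventually_elim blast
    ultimately show ?case unfolding enat_bigtheta_def by blast
  qed
qed

end
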